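(* Let $M$ be a regular analytic surface in the Minkowski space $\mathbb R^3_1$, let ${\rm p}\in M$ be an umbilic point, and let $\omega_P$ be the binary differential equation of the lines of principal curvature of $M$ at ${\rm p}$. Suppose that the multiplicity $m_u({\rm p})$ of the umbilic point and the multiplicity $m(\omega_P)$ of the binary differential equation are finite. Then $m(\omega_P)\ge 3\,m_u({\rm p})$.
   Context: $\mathbb R^3_1$ is $\mathbb R^3$ with the pseudo-scalar product $\langle u,v\rangle=u_0v_0+u_1v_1-u_2v_2$; $\times$ is the corresponding vector product, $\langle u\times v,w\rangle=\det(u,v,w)$. Let $\mathbf x:U\subset\mathbb R^2\to M$ be a local (analytic) parametrisation, with parameters $(u,v)$. Put $E=\langle \mathbf x_u,\mathbf x_u\rangle$, $F=\langle \mathbf x_u,\mathbf x_v\rangle$, $G=\langle \mathbf x_v,\mathbf x_v\rangle$, $\bar l=\langle \mathbf x_u\times \mathbf x_v,\mathbf x_{uu}\rangle$, $\bar m=\langle \mathbf x_u\times \mathbf x_v,\mathbf x_{uv}\rangle$, $\bar n=\langle \mathbf x_u\times \mathbf x_v,\mathbf x_{vv}\rangle$, and $$\mathfrak a=F\bar n-G\bar m,\quad \mathfrak b=E\bar n-G\bar l,\quad \mathfrak c=E\bar m-F\bar l .$$ The lines of principal curvature (extended also to points where the induced metric is degenerate) are the solutions of the binary differential equation $\omega_P:\ \mathfrak a\,dv^2+\mathfrak b\,du\,dv+\mathfrak c\,du^2=0$. A point ${\rm p}=\mathbf x(q)$ is an umbilic point if $\mathfrak a(q)=\mathfrak b(q)=\mathfrak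 c(q)=0$. Take $q$ to be the origin. Let $\mathcal O_2$ be the ring of germs at the origin of holomorphic functions in two variables, and for germs $h,k$ let $m(h,k)=\dim_{\mathbb C}\mathcal O_2/\langle h,k\rangle$ (real analytic germs are complexified). At any point of $M$, $E,F,G$ are not all zero. The multiplicity $m_u({\rm p})$ of the umbilic point (which counts the maximum number of umbilic points into which it can split under deformations of the surface) is given by $m_u({\rm p})=m(\mathfrak b,\mathfrak c)$ if $E(q)\neq0$, $m(\mathfrak a,\mathfrak c)$ if $F(q)\ne 0$, $m(\mathfrak a,\mathfrak b)$ if $G(q)\neq 0$ (equivalently $\dim_{\mathbb C}\mathcal O_2/\langle \mathfrak a,\mathfrak b,\mathfrak c\rangle$). The multiplicity at the origin of an analytic binary differential equation $\omega: a\,dv^2+b\,du\,dv+c\,du^2=0$, with discriminant function $\delta=b^2-4ac$, is $$m(\omega)=\tfrac12\dim_{\mathbb C}\mathcal O_2/\langle \delta,\ a\delta_u^2-b\delta_u\delta_v+c\delta_v^2\rangle .$$ *)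

theory Defs
  imports "HOL-Complex_Analysis.Complex_Analysis" "HOL-Algebra.Algebraic_Closure_Type"
begin

section \<open>The ring of germs at the origin of holomorphic functions in two variables\<close>

definition holomorphic2_on :: "(complex \<times> complex \<Rightarrow> complex) \<Rightarrow> (complex \<times> complex) set \<Rightarrow> bool"
  where "holomorphic2_on f S \<longleftrightarrow>
    (\<forall>p\<in>S. \<exists>A B. (f has_derivative (\<lambda>(h, k). A * h + B * k)) (at p))"

definition holomorphic2_near_0 :: "(complex \<times> complex \<Rightarrow> complex) \<Rightarrow> bool"
  where "holomorphic2_near_0 f \<longleftrightarrow> (\<exists>S. open S \<and> (0, 0) \<in> S \<and> holomorphic2_on f S)"

definition germ_eq :: "(complex \<times> complex \<Rightarrow> complex) \<Rightarrow> (complex \<times> complex \<Rightarrow> complex) \<Rightarrow> bool"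
  where "germ_eq f g \<longleftrightarrow> holomorphic2_near_0 f \<and> holomorphic2_near_0 g \<and>
    (\<forall>\<^sub>F p in nhds (0, 0). f p = g p)"

lemma holomorphic2_near_0_const: "holomorphic2_near_0 (\<lambda>_. c)"
  unfolding holomorphic2_near_0_def holomorphic2_on_def
  by (rule exI[of _ UNIV]) (auto intro!: exI[of _ 0] simp: case_prod_unfold)

lemma holomorphic2_near_0_lin:
  assumes "holomorphic2_near_0 f" "holomorphic2_near_0 g"
  shows "holomorphic2_near_0 (\<lambda>p. f p + g p)" (is ?add)
    and "holomorphic2_near_0 (\<lambda>p. f p * g p)" (is ?mult)
proof -
  from assms obtain S T where S: "open S" "(0, 0) \<in> S" "holomorphic2_on f S"
    and T: "open T" "(0, 0) \<in> T" "holomorphic2_on g T"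
    unfolding holomorphic2_near_0_def by blast
  have "\<exists>A B. ((\<lambda>p. f p + g p) has_derivative (\<lambda>(h, k). A * h + B * k)) (at p)"
   and "\<exists>A B. ((\<lambda>p. f p * g p) has_derivative (\<lambda>(h, k). A * h + B * k)) (at p)"
    if p: "p \<in> S \<inter> T" for p
  proof -
    from S(3) p obtain A B where f: "(f has_derivative (\<lambda>(h, k). A * h + B * k)) (at p)"
      unfolding holomorphic2_on_def by blast
    from T(3) p obtain C D where g: "(g has_derivative (\<lambda>(h, k). C * h + D * k)) (at p)"
      unfolding holomorphic2_on_def by blast
    have "((\<lambda>p. f p + g p) has_derivative (\<lambda>(h, k). (A + C) * h + (B + D) * k)) (at p)"
      using has_derivative_add[OF f g]
      by (rule has_derivative_eq_rhs) (auto simp: fun_eq_iff algebra_simps)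
    then show "\<exists>A B. ((\<lambda>p. f p + g p) has_derivative (\<lambda>(h, k). A * h + B * k)) (at p)" by blast
    have "((\<lambda>p. f p * g p) has_derivative
        (\<lambda>(h, k). (f p * C + A * g p) * h + (f p * D + B * g p) * k)) (at p)"
      using has_derivative_mult[OF f g]
      by (rule has_derivative_eq_rhs) (auto simp: fun_eq_iff algebra_simps)
    then show "\<exists>A B. ((\<lambda>p. f p * g p) has_derivative (\<lambda>(h, k). A * h + B * k)) (at p)" by blast
  qed
  then show ?add ?mult
    unfolding holomorphic2_near_0_def holomorphic2_on_def
    using S T by (auto intro!: exI[of _ "S \<inter> T"])
qed

lemma holomorphic2_near_0_uminus:
  assumes "holomorphic2_near_0 f"
  shows "holomorphic2_near_0 (\<lambda>p. - f p)"
  using holomorphic2_near_0_lin(2)[OF holomorphic2_near_0_const[of "-1"] assms] by simp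

lemma holomorphic2_near_0_diff:
  assumes "holomorphic2_near_0 f" "holomorphic2_near_0 g"
  shows "holomorphic2_near_0 (\<lambda>p. f p - g p)"
  using holomorphic2_near_0_lin(1)[OF assms(1) holomorphic2_near_0_uminus[OF assms(2)]] by simp

lemma germ_eq_sym: "germ_eq f g \<Longrightarrow> germ_eq g f"
  unfolding germ_eq_def by (auto elim: eventually_mono)

lemma germ_eq_trans: "germ_eq f g \<Longrightarrow> germ_eq g h \<Longrightarrow> germ_eq f h"
  unfolding germ_eq_def by (auto elim: eventually_elim2)

quotient_type germ2 = "complex \<times> complex \<Rightarrow> complex" / partial: germ_eq
proof (rule part_equivpI)
  show "\<exists>f. germ_eq f f"
    by (rule exI[of _ "\<lambda>_. 0"]) (simp add: germ_eq_def holomorphic2_near_0_const)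
qed (auto intro: sympI transpI germ_eq_sym germ_eq_trans)

instantiation germ2 :: comm_ring_1
begin

lift_definition zero_germ2 :: germ2 is "\<lambda>_. 0"
  by (simp add: germ_eq_def holomorphic2_near_0_const)

lift_definition one_germ2 :: germ2 is "\<lambda>_. 1"
  by (simp add: germ_eq_def holomorphic2_near_0_const)

lift_definition plus_germ2 :: "germ2 \<Rightarrow> germ2 \<Rightarrow> germ2" is "\<lambda>f g p. f p + g p"
  unfolding germ_eq_def by (auto intro: holomorphic2_near_0_lin elim: eventually_elim2)

lift_definition times_germ2 :: "germ2 \<Rightarrow> germ2 \<Rightarrow> germ2" is "\<lambda>f g p. f p * g p"
  unfolding germ_eq_def by (auto intro: holomorphic2_near_0_lin elim: eventually_elim2)

lift_definition uminus_germ2 :: "germ2 \<Rightarrow> germ2" is "\<lambda>f p. - f p"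
  unfolding germ_eq_def by (auto intro: holomorphic2_near_0_uminus elim: eventually_mono)

lift_definition minus_germ2 :: "germ2 \<Rightarrow> germ2 \<Rightarrow> germ2" is "\<lambda>f g p. f p - g p"
  unfolding germ_eq_def by (auto intro: holomorphic2_near_0_diff elim: eventually_elim2)

instance
proof
  have const: "germ_eq (\<lambda>_. c) (\<lambda>_. c)" for c
    by (simp add: germ_eq_def holomorphic2_near_0_const)
  show "(0::germ2) \<noteq> 1"
  proof (transfer, rule notI)
    assume "germ_eq (\<lambda>_. 0) (\<lambda>_. 1)"
    then have "\<forall>\<^sub>F p in nhds ((0, 0) :: complex \<times> complex). (0::complex) = 1"
      by (simp add: germ_eq_def)
    then show False by (auto dest: eventually_nhds_x_imp_x)
  qed
qed (transfer, simp add: germ_eq_def algebra_simps holomorphic2_near_0_const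
        holomorphic2_near_0_lin holomorphic2_near_0_diff holomorphic2_near_0_uminus)+

end

lift_definition const_germ :: "complex \<Rightarrow> germ2" is "\<lambda>c _. c"
  by (simp add: germ_eq_def holomorphic2_near_0_const)

lift_definition is_germ_of :: "germ2 \<Rightarrow> (complex \<times> complex \<Rightarrow> complex) \<Rightarrow> bool" is germ_eq
  unfolding germ_eq_def fun_eq_iff by (auto elim: eventually_elim2)

text \<open>
  The dimension over the complex numbers of the quotient of the germ ring by the ideal
  generated by \<open>h\<close> and \<open>k\<close>; the scalars act through the classes of the constant germs.
\<close>

definition intersection_multiplicity :: "germ2 \<Rightarrow> germ2 \<Rightarrow> enat"
  where "intersection_multiplicity h k =
    (let R = (ring_of_type_algebra :: germ2 ring);
         I = genideal R {h, k};
         Q = R Quot I;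
         K = range (\<lambda>c. I +>\<^bsub>R\<^esub> const_germ c)
     in if ring.finite_dimension Q K (carrier Q) then enat (ring.dim Q K (carrier Q)) else \<infinity>)"


section \<open>Real analytic functions of two variables and their complexification\<close>

definition real_analytic_at :: "(real \<times> real \<Rightarrow> 'a::real_normed_vector) \<Rightarrow> real \<times> real \<Rightarrow> bool"
  where "real_analytic_at f q \<longleftrightarrow>
    (\<exists>c. \<forall>\<^sub>F p in nhds q.
      ((\<lambda>(i, j). ((fst p - fst q) ^ i * (snd p - snd q) ^ j) *\<^sub>R c (i, j)) has_sum f p) UNIV)"

definition is_complexification :: "(real \<times> real \<Rightarrow> real) \<Rightarrow> germ2 \<Rightarrow> bool"
  where "is_complexification f g \<longleftrightarrow>
    (\<exists>F. is_germ_of g F \<and>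
      (\<forall>\<^sub>F p in nhds (0, 0). F (of_real (fst p), of_real (snd p)) = of_real (f p)))"

text \<open>Well defined for functions that are real analytic at the origin; see
  \<open>ex1_complexification\<close> below.\<close>

definition complexification :: "(real \<times> real \<Rightarrow> real) \<Rightarrow> germ2"
  where "complexification f = (THE g. is_complexification f g)"

lemma slices_holomorphic:
  assumes "holomorphic2_on F S" "open S" "\<And>z w. z \<in> ball 0 r \<Longrightarrow> w \<in> ball 0 r \<Longrightarrow> (z, w) \<in> S"
  shows "w \<in> ball 0 r \<Longrightarrow> (\<lambda>z. F (z, w)) holomorphic_on ball 0 r"
    and "z \<in> ball 0 r \<Longrightarrow> (\<lambda>w. F (z, w)) holomorphic_on ball 0 r"
proof -
  show "(\<lambda>z. F (z, w)) holomorphic_on ball 0 r" if w: "w \<in> ball 0 r" for w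
  proof (rule holomorphic_onI)
    fix z assume "z \<in> ball (0::complex) r"
    with assms w obtain A B where "(F has_derivative (\<lambda>(h, k). A * h + B * k)) (at (z, w))"
      unfolding holomorphic2_on_def by blast
    then have F: "(F has_derivative (\<lambda>(h, k). A * h + B * k)) (at ((\<lambda>z. (z, w)) z))" by simp
    have 1: "((\<lambda>z. (z, w)) has_derivative (\<lambda>h. (h, 0))) (at z)"
      by (auto intro!: derivative_eq_intros)
    have "((\<lambda>z. F (z, w)) has_derivative (\<lambda>h. (\<lambda>(h, k). A * h + B * k) (h, 0))) (at z)"
      by (rule has_derivative_compose[OF 1 F])
    then have "((\<lambda>z. F (z, w)) has_field_derivative A) (at z)"
      by (simp add: has_field_derivative_def)
    then show "(\<lambda>z. F (z, w)) field_differentiable at z within ball 0 r"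
      using field_differentiable_at_within field_differentiable_def by blast
  qed
  show "(\<lambda>w. F (z, w)) holomorphic_on ball 0 r" if z: "z \<in> ball 0 r" for z
  proof (rule holomorphic_onI)
    fix w assume "w \<in> ball (0::complex) r"
    with assms z obtain A B where "(F has_derivative (\<lambda>(h, k). A * h + B * k)) (at (z, w))"
      unfolding holomorphic2_on_def by blast
    then have F: "(F has_derivative (\<lambda>(h, k). A * h + B * k)) (at (Pair z w))" by simp
    have 1: "(Pair z has_derivative (\<lambda>h. (0, h))) (at w)"
      by (auto intro!: derivative_eq_intros)
    have "((\<lambda>w. F (z, w)) has_derivative (\<lambda>h. (\<lambda>(h, k). A * h + B * k) (0, h))) (at w)"
      by (rule has_derivative_compose[OF 1 F])
    then have "((\<lambda>w. F (z, w)) has_field_derivative B) (at w)"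
      by (simp add: has_field_derivative_def)
    then show "(\<lambda>w. F (z, w)) field_differentiable at w within ball 0 r"
      using field_differentiable_at_within field_differentiable_def by blast
  qed
qed

lemma holomorphic_zero_on_reals:
  assumes "f holomorphic_on ball 0 r" "r > 0" "\<And>t. \<bar>t\<bar> < r \<Longrightarrow> f (of_real t) = 0" "z \<in> ball 0 r"
  shows "f z = 0"
proof (rule analytic_continuation[OF assms(1), of "of_real ` {-r<..<r}" 0])
  have "(0::real) islimpt {-r<..<r}"
    using \<open>r > 0\<close> by (simp add: open_imp_islimpt)
  show "(0::complex) islimpt complex_of_real ` {-r<..<r}"
  proof (rule islimptI)
    fix T :: "complex set" assume "0 \<in> T" "open T"
    then obtain e where e: "e > 0" "ball 0 e \<subseteq> T" by (meson open_contains_ball)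
    show "\<exists>y\<in>complex_of_real ` {-r<..<r}. y \<in> T \<and> y \<noteq> 0"
    proof
      show "complex_of_real (min e r / 2) \<in> complex_of_real ` {-r<..<r}"
        using e(1) \<open>r > 0\<close> by (intro imageI) (auto simp: min_def)
      have "complex_of_real (min e r / 2) \<in> ball 0 e"
        using e(1) \<open>r > 0\<close> by (simp add: min_def)
      then show "complex_of_real (min e r / 2) \<in> T \<and> complex_of_real (min e r / 2) \<noteq> 0"
        using e \<open>r > 0\<close> by auto
    qed
  qed
qed (use assms in auto)

lemma nhds_00_box:
  fixes P :: "'a::real_normed_vector \<times> 'b::real_normed_vector \<Rightarrow> bool"
  assumes "\<forall>\<^sub>F p in nhds (0, 0). P p"
  obtains r where "r > 0" "\<And>z w. norm z < r \<Longrightarrow> norm w < r \<Longrightarrow> P (z, w)"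
proof -
  from assms obtain e where e: "e > 0" "\<And>p. dist p (0, 0) < e \<Longrightarrow> P p"
    unfolding eventually_nhds_metric by blast
  have "P (z, w)" if "norm z < e / 2" "norm w < e / 2" for z w
  proof -
    have "norm (z, w) \<le> norm z + norm w" by (rule norm_Pair_le)
    with that have "norm (z, w) < e" by linarith
    then show ?thesis by (intro e(2)) (simp add: dist_norm)
  qed
  with e(1) show ?thesis by (intro that[of "e / 2"]) auto
qed

lemma box_nhds_00:
  assumes "r > 0" "\<And>z w. norm z < r \<Longrightarrow> norm w < r \<Longrightarrow> P (z, w)"
  shows "\<forall>\<^sub>F p in nhds (0::'a::real_normed_vector, 0::'b::real_normed_vector). P p"
proof -
  have "open (ball (0::'a) r \<times> ball (0::'b) r)" by (intro open_Times) auto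
  moreover have "(0, 0) \<in> ball (0::'a) r \<times> ball (0::'b) r" using assms(1) by simp
  ultimately show ?thesis
    using assms(2) by (auto simp: eventually_nhds)
qed

lemma germ_eq_if_eq_on_reals:
  assumes F: "holomorphic2_near_0 F" and G: "holomorphic2_near_0 G"
    and eq: "\<forall>\<^sub>F p in nhds (0, 0). F (of_real (fst p), of_real (snd p)) =
                                  G (of_real (fst p), of_real (snd p))"
  shows "germ_eq F G"
proof -
  define D where "D = (\<lambda>p. F p - G p)"
  have "holomorphic2_near_0 D"
    unfolding D_def by (rule holomorphic2_near_0_diff[OF F G])
  then obtain S where S: "open S" "(0, 0) \<in> S" "holomorphic2_on D S"
    unfolding holomorphic2_near_0_def by blast
  have "\<forall>\<^sub>F p in nhds (0, 0). p \<in> S" using S eventually_nhds by blast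
  then obtain r1 where r1: "r1 > 0" "\<And>z w. norm z < r1 \<Longrightarrow> norm w < r1 \<Longrightarrow> (z, w) \<in> S"
    using nhds_00_box by blast
  from eq obtain r2 where r2: "r2 > 0" "\<And>u v. norm u < r2 \<Longrightarrow> norm v < r2 \<Longrightarrow>
      F (of_real u, of_real v) = G (of_real u, of_real v)"
    by (rule nhds_00_box) auto
  define r where "r = min r1 r2"
  have r: "r > 0" "\<And>z w. z \<in> ball 0 r \<Longrightarrow> w \<in> ball 0 r \<Longrightarrow> (z, w) \<in> S"
    "\<And>u v. \<bar>u\<bar> < r \<Longrightarrow> \<bar>v\<bar> < r \<Longrightarrow> D (of_real u, of_real v) = 0"
    using r1 r2 by (auto simp: r_def D_def)
  have holz: "(\<lambda>z. D (z, w)) holomorphic_on ball 0 r" if "w \<in> ball 0 r" for w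
    by (rule slices_holomorphic(1)[OF S(3,1) _ that]) (use r(2) in blast)
  have holw: "(\<lambda>w. D (z, w)) holomorphic_on ball 0 r" if "z \<in> ball 0 r" for z
    by (rule slices_holomorphic(2)[OF S(3,1) _ that]) (use r(2) in blast)
  have 1: "D (z, of_real v) = 0" if z: "z \<in> ball 0 r" and v: "\<bar>v\<bar> < r" for z v
    by (rule holomorphic_zero_on_reals[OF holz r(1) _ z]) (use r(3) v in auto)
  have "D (z, w) = 0" if z: "z \<in> ball 0 r" and w: "w \<in> ball 0 r" for z w
    by (rule holomorphic_zero_on_reals[OF holw[OF z] r(1) _ w]) (use 1 z in auto)
  then have "\<forall>\<^sub>F p in nhds (0, 0). D p = 0"
    by (intro box_nhds_00[OF r(1)]) simp
  then show ?thesis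
    using F G by (simp add: germ_eq_def D_def)
qed

lemma complexification_unique:
  assumes "is_complexification f g" "is_complexification f h"
  shows "g = h"
proof -
  from assms(1) obtain F where F: "is_germ_of g F"
      "\<forall>\<^sub>F p in nhds (0, 0). F (of_real (fst p), of_real (snd p)) = of_real (f p)"
    unfolding is_complexification_def by blast
  from assms(2) obtain H where H: "is_germ_of h H"
      "\<forall>\<^sub>F p in nhds (0, 0). H (of_real (fst p), of_real (snd p)) = of_real (f p)"
    unfolding is_complexification_def by blast
  have "\<forall>\<^sub>F p in nhds (0, 0). F (of_real (fst p), of_real (snd p)) =
                             H (of_real (fst p), of_real (snd p))"
    using F(2) H(2) by eventually_elim simp
  then have "germ_eq F H"
    using F(1) H(1) by (intro germ_eq_if_eq_on_reals) (transfer; simp add: germ_eq_def)+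
  with F(1) H(1) show ?thesis
    by transfer (blast intro: germ_eq_sym germ_eq_trans)
qed

lemma power_series_holomorphic2:
  fixes c :: "nat \<times> nat \<Rightarrow> real"
  assumes "\<rho> > 0" and sm: "(\<lambda>(i, j). \<bar>c (i, j)\<bar> * \<rho> ^ (i + j)) summable_on UNIV"
  shows "holomorphic2_near_0 (\<lambda>(z, w). \<Sum>n. case prod_decode n of (i, j) \<Rightarrow>
           of_real (c (i, j)) * z ^ i * w ^ j)"
proof -
  define \<sigma> where "\<sigma> = \<rho> / 2"
  define I where "I n = fst (prod_decode n)" for n
  define J where "J n = snd (prod_decode n)" for n
  define C where "C n = complex_of_real (c (I n, J n))" for n
  define f where "f n = (\<lambda>p::complex\<times>complex. C n * fst p ^ I n * snd p ^ J n)" for n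
  define A where "A n = (\<lambda>p::complex\<times>complex. C n * (of_nat (I n) * fst p ^ (I n - 1)) * snd p ^ J n)" for n
  define B where "B n = (\<lambda>p::complex\<times>complex. C n * fst p ^ I n * (of_nat (J n) * snd p ^ (J n - 1)))" for n
  define M where "M n = norm (C n) * \<rho> ^ (I n + J n) / \<sigma>" for n
  define S where "S = ball (0::complex) \<sigma> \<times> ball (0::complex) \<sigma>"
  have \<sigma>: "\<sigma> > 0" using assms(1) by (simp add: \<sigma>_def)
  have "((\<lambda>(i, j). \<bar>c (i, j)\<bar> * \<rho> ^ (i + j)) \<circ> prod_decode) summable_on UNIV"
    using sm by (subst summable_on_reindex[symmetric]) (auto simp: inj_prod_decode surj_prod_decode)
  then have "summable (\<lambda>n. norm (C n) * \<rho> ^ (I n + J n))"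
    by (intro summable_on_imp_summable)
       (auto simp: o_def case_prod_unfold C_def I_def J_def)
  then have M: "summable M" unfolding M_def by (rule summable_divide)
  have pw: "of_nat (k + l) * \<sigma> ^ (k + l - 1) \<le> \<rho> ^ (k + l) / \<sigma>" for k l :: nat
  proof (cases "k + l")
    case (Suc n)
    have "real (Suc n) \<le> 2 ^ Suc n" using of_nat_less_two_power[of "Suc n", where 'a=real] by linarith
    then have "real (Suc n) * \<sigma> ^ Suc n \<le> 2 ^ Suc n * \<sigma> ^ Suc n"
      using \<sigma> by (intro mult_right_mono) auto
    also have "\<dots> = \<rho> ^ Suc n" by (simp add: \<sigma>_def power_divide del: power_Suc)
    finally show ?thesis using \<sigma> Suc by (simp add: field_simps)
  qed (use \<sigma> assms in simp)
  have bA: "norm (A n p) \<le> M n" and bB: "norm (B n p) \<le> M n" if "p \<in> S" for n p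
  proof -
    have p: "norm (fst p) \<le> \<sigma>" "norm (snd p) \<le> \<sigma>" using that by (auto simp: S_def)
    have "norm (A n p) = norm (C n) * (real (I n) * (norm (fst p) ^ (I n - 1) * norm (snd p) ^ J n))"
      by (simp add: A_def norm_mult norm_power)
    also have "\<dots> \<le> norm (C n) * (real (I n) * (\<sigma> ^ (I n - 1) * \<sigma> ^ J n))"
      using p \<sigma> by (intro mult_left_mono mult_mono power_mono) auto
    also have "\<dots> \<le> norm (C n) * (real (I n + J n) * \<sigma> ^ (I n + J n - 1))"
    proof (cases "I n")
      case (Suc k)
      then show ?thesis using \<sigma>
        by (intro mult_left_mono mult_mono) (auto simp: power_add)
    qed (use \<sigma> in simp)
    also have "\<dots> \<le> norm (C n) * (\<rho> ^ (I n + J n) / \<sigma>)"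
      by (intro mult_left_mono pw) auto
    finally show "norm (A n p) \<le> M n" by (simp add: M_def)
    have "norm (B n p) = norm (C n) * (real (J n) * (norm (fst p) ^ I n * norm (snd p) ^ (J n - 1)))"
      by (simp add: B_def norm_mult norm_power)
    also have "\<dots> \<le> norm (C n) * (real (J n) * (\<sigma> ^ I n * \<sigma> ^ (J n - 1)))"
      using p \<sigma> by (intro mult_left_mono mult_mono power_mono) auto
    also have "\<dots> \<le> norm (C n) * (real (I n + J n) * \<sigma> ^ (I n + J n - 1))"
    proof (cases "J n")
      case (Suc k)
      then show ?thesis using \<sigma>
        by (intro mult_left_mono mult_mono) (auto simp: power_add)
    qed (use \<sigma> in simp)
    also have "\<dots> \<le> norm (C n) * (\<rho> ^ (I n + J n) / \<sigma>)"
      by (intro mult_left_mono pw) auto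
    finally show "norm (B n p) \<le> M n" by (simp add: M_def)
  qed
  define a where "a p = (\<Sum>n. A n p)" for p
  define b where "b p = (\<Sum>n. B n p)" for p
  have uA: "uniform_limit S (\<lambda>n p. \<Sum>i<n. A i p) a sequentially"
    unfolding a_def by (rule Weierstrass_m_test[OF bA M])
  have uB: "uniform_limit S (\<lambda>n p. \<Sum>i<n. B i p) b sequentially"
    unfolding b_def by (rule Weierstrass_m_test[OF bB M])
  have "\<exists>g. \<forall>p\<in>S. (\<lambda>n. f n p) sums g p \<and>
      (g has_derivative (\<lambda>(h, k). a p * h + b p * k)) (at p within S)"
  proof (rule has_derivative_series[where f = f and x = "(0, 0)" and l = "\<Sum>n. f n (0,0)"])
    show "convex S" unfolding S_def by (intro convex_Times) auto
    show "(0, 0) \<in> S" using \<sigma> by (simp add: S_def)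
    show "(f n has_derivative (\<lambda>(h, k). A n p * h + B n p * k)) (at p within S)" if "p \<in> S" for n p
      unfolding f_def A_def B_def
      by (auto intro!: derivative_eq_intros simp: fun_eq_iff algebra_simps case_prod_unfold)
    have "f n (0, 0) = 0" if "n \<noteq> prod_encode (0, 0)" for n
    proof -
      have "prod_decode n \<noteq> (0, 0)" using that by (metis prod_decode_inverse)
      then have "I n \<noteq> 0 \<or> J n \<noteq> 0" by (auto simp: I_def J_def prod_eq_iff)
      then show ?thesis by (auto simp: f_def)
    qed
    then show "(\<lambda>n. f n (0, 0)) sums (\<Sum>n. f n (0,0))"
      by (intro summable_sums summable_finite[of "{prod_encode (0, 0)}"]) auto
    show "\<forall>\<^sub>F n in sequentially. \<forall>p\<in>S. \<forall>h.
        norm ((\<Sum>i<n. (case h of (h, k) \<Rightarrow> A i p * h + B i p * k)) -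
              (case h of (h, k) \<Rightarrow> a p * h + b p * k)) \<le> e * norm h" if "e > 0" for e
    proof -
      have "\<forall>\<^sub>F n in sequentially. \<forall>p\<in>S. dist (\<Sum>i<n. A i p) (a p) < e / 2"
        using uA that unfolding uniform_limit_iff by (auto dest!: spec[of _ "e / 2"])
      moreover have "\<forall>\<^sub>F n in sequentially. \<forall>p\<in>S. dist (\<Sum>i<n. B i p) (b p) < e / 2"
        using uB that unfolding uniform_limit_iff by (auto dest!: spec[of _ "e / 2"])
      ultimately show ?thesis
      proof eventually_elim
        case (elim n)
        show ?case
        proof (intro ballI allI)
          fix p and hk :: "complex \<times> complex" assume p: "p \<in> S"
          obtain h k where hk: "hk = (h, k)" by force
          have "(\<Sum>i<n. A i p * h + B i p * k) - (a p * h + b p * k) =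
              ((\<Sum>i<n. A i p) - a p) * h + ((\<Sum>i<n. B i p) - b p) * k"
            by (simp add: sum.distrib sum_distrib_right left_diff_distrib)
          also have "norm \<dots> \<le> norm ((\<Sum>i<n. A i p) - a p) * norm h +
              norm ((\<Sum>i<n. B i p) - b p) * norm k"
            by (metis norm_mult norm_triangle_ineq)
          also have "\<dots> \<le> e / 2 * norm hk + e / 2 * norm hk"
          proof (intro add_mono mult_mono)
            show "norm h \<le> norm hk" using norm_fst_le[of h k] by (simp add: hk)
            show "norm k \<le> norm hk" using norm_snd_le[of k h] by (simp add: hk)
          qed (use elim p that in \<open>auto simp: dist_norm less_imp_le\<close>)
          finally show "norm ((\<Sum>i<n. (case hk of (h, k) \<Rightarrow> A i p * h + B i p * k)) -
              (case hk of (h, k) \<Rightarrow> a p * h + b p * k)) \<le> e * norm hk"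
            by (simp add: hk)
        qed
      qed
    qed
  qed
  then obtain g where g: "\<And>p. p \<in> S \<Longrightarrow> (\<lambda>n. f n p) sums g p"
      "\<And>p. p \<in> S \<Longrightarrow> (g has_derivative (\<lambda>(h, k). a p * h + b p * k)) (at p within S)"
    by blast
  have oS: "open S" unfolding S_def by (intro open_Times) auto
  let ?F = "\<lambda>(z, w). \<Sum>n. case prod_decode n of (i, j) \<Rightarrow> of_real (c (i, j)) * z ^ i * w ^ j"
  have F: "?F p = g p" if "p \<in> S" for p
    using sums_unique[OF g(1)[OF that]]
    by (simp add: f_def C_def I_def J_def case_prod_unfold)
  have "(?F has_derivative (\<lambda>(h, k). a p * h + b p * k)) (at p)" if "p \<in> S" for p
  proof -
    have "(g has_derivative (\<lambda>(h, k). a p * h + b p * k)) (at p)"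
      using g(2)[OF that] at_within_open[OF that oS] by simp
    then show ?thesis
      by (rule has_derivative_transform_within_open[OF _ oS that]) (use F in auto)
  qed
  then have "holomorphic2_on ?F S" unfolding holomorphic2_on_def by blast
  moreover have "(0, 0) \<in> S" using \<sigma> by (simp add: S_def)
  ultimately show ?thesis using oS unfolding holomorphic2_near_0_def by blast
qed

lemma complexification_exists:
  assumes "real_analytic_at f (0, 0)"
  shows "\<exists>g. is_complexification f g"
proof -
  from assms obtain c where "\<forall>\<^sub>F p in nhds (0, 0).
      ((\<lambda>(i, j). (fst p ^ i * snd p ^ j) * c (i, j)) has_sum f p) UNIV"
    unfolding real_analytic_at_def by auto
  then obtain r where r: "r > 0" "\<And>u v. norm u < r \<Longrightarrow> norm v < r \<Longrightarrow>
      ((\<lambda>(i, j). (u ^ i * v ^ j) * c (i, j)) has_sum f (u, v)) UNIV"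
    by (rule nhds_00_box) auto
  define \<rho> where "\<rho> = r / 2"
  have \<rho>: "\<rho> > 0" "\<rho> < r" using r(1) by (auto simp: \<rho>_def)
  have "(\<lambda>(i, j). (\<rho> ^ i * \<rho> ^ j) * c (i, j)) summable_on UNIV"
    using r(2)[of \<rho> \<rho>] \<rho> has_sum_imp_summable by fastforce
  from iffD1[OF summable_on_iff_abs_summable_on_real this] have sm: "(\<lambda>(i, j). \<bar>c (i, j)\<bar> * \<rho> ^ (i + j)) summable_on UNIV"
    using \<rho>(1) by (simp add: case_prod_unfold abs_mult power_add mult_ac)
  define F where "F = (\<lambda>(z::complex, w). \<Sum>n. case prod_decode n of (i, j) \<Rightarrow>
           of_real (c (i, j)) * z ^ i * w ^ j)"
  have F: "holomorphic2_near_0 F"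
    unfolding F_def by (rule power_series_holomorphic2[OF \<rho>(1) sm])
  have "F (of_real u, of_real v) = of_real (f (u, v))" if "norm u < r" "norm v < r" for u v
  proof -
    have "((\<lambda>(i, j). (u ^ i * v ^ j) * c (i, j)) \<circ> prod_decode has_sum f (u, v)) UNIV"
      using r(2)[OF that] by (subst has_sum_reindex[symmetric]) (auto simp: inj_prod_decode surj_prod_decode)
    then have "((\<lambda>(i, j). (u ^ i * v ^ j) * c (i, j)) \<circ> prod_decode) sums f (u, v)"
      by (rule has_sum_imp_sums)
    then have "(\<lambda>n. complex_of_real (((\<lambda>(i, j). (u ^ i * v ^ j) * c (i, j)) \<circ> prod_decode) n)) sums
        of_real (f (u, v))"
      by (rule sums_of_real)
    then show ?thesis
      unfolding F_def by (auto simp: case_prod_unfold mult_ac dest!: sums_unique)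
  qed
  then have "\<forall>\<^sub>F p in nhds (0, 0). F (of_real (fst p), of_real (snd p)) = of_real (f p)"
    by (intro box_nhds_00[OF r(1)]) auto
  moreover have "\<exists>g. is_germ_of g F"
    using F by transfer (auto simp: germ_eq_def)
  ultimately show ?thesis unfolding is_complexification_def by blast
qed

lemma ex1_complexification:
  assumes "real_analytic_at f (0, 0)"
  shows "\<exists>!g. is_complexification f g"
  using complexification_exists[OF assms] complexification_unique by blast

definition partial_u :: "(real \<times> real \<Rightarrow> 'a::real_normed_vector) \<Rightarrow> real \<times> real \<Rightarrow> 'a"
  where "partial_u f p = vector_derivative (\<lambda>s. f (s, snd p)) (at (fst p))"

definition partial_v :: "(real \<times> real \<Rightarrow> 'a::real_normed_vector) \<Rightarrow> real \<times> real \<Rightarrow> 'a"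
  where "partial_v f p = vector_derivative (\<lambda>t. f (fst p, t)) (at (snd p))"

text \<open>The multiplicity \<open>m(h, k)\<close> of two real analytic germs at the origin.\<close>

definition real_multiplicity :: "(real \<times> real \<Rightarrow> real) \<Rightarrow> (real \<times> real \<Rightarrow> real) \<Rightarrow> enat"
  where "real_multiplicity h k =
    intersection_multiplicity (complexification h) (complexification k)"


section \<open>Binary differential equations\<close>

text \<open>The triple \<open>(a, b, c)\<close> stands for the equation \<open>a dv\<^sup>2 + b du dv + c du\<^sup>2 = 0\<close>.\<close>

type_synonym bde =
  "(real \<times> real \<Rightarrow> real) \<times> (real \<times> real \<Rightarrow> real) \<times> (real \<times> real \<Rightarrow> real)"

definition bde_discriminant :: "bde \<Rightarrow> real \<times> real \<Rightarrow> real"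
  where "bde_discriminant = (\<lambda>(a, b, c) p. (b p)\<^sup>2 - 4 * a p * c p)"

definition bde_multiplicity :: "bde \<Rightarrow> ereal"
  where "bde_multiplicity = (\<lambda>(a, b, c).
    let \<delta> = bde_discriminant (a, b, c); \<delta>u = partial_u \<delta>; \<delta>v = partial_v \<delta>
    in ereal_of_enat
         (real_multiplicity \<delta> (\<lambda>p. a p * (\<delta>u p)\<^sup>2 - b p * \<delta>u p * \<delta>v p + c p * (\<delta>v p)\<^sup>2)) / 2)"


no_notation fps_nth (infixl "$" 75)

section \<open>Surfaces in Minkowski 3-space\<close>

text \<open>The coordinates \<open>u\<^sub>0, u\<^sub>1, u\<^sub>2\<close> are \<open>u $ 1, u $ 2, u $ 3\<close>.\<close>

definition mink_inner :: "real ^ 3 \<Rightarrow> real ^ 3 \<Rightarrow> real"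
  where "mink_inner u v = u $ 1 * v $ 1 + u $ 2 * v $ 2 - u $ 3 * v $ 3"

definition mink_cross :: "real ^ 3 \<Rightarrow> real ^ 3 \<Rightarrow> real ^ 3"
  where "mink_cross u v =
    vector [u $ 2 * v $ 3 - u $ 3 * v $ 2,
            u $ 3 * v $ 1 - u $ 1 * v $ 3,
            u $ 2 * v $ 1 - u $ 1 * v $ 2]"

lemma mink_inner_cross: "mink_inner (mink_cross u v) w = det (vector [u, v, w])"
  by (simp add: mink_inner_def mink_cross_def det_3 algebra_simps)

lemma mink_cross_unique:
  assumes "\<And>w. mink_inner z w = det (vector [u, v, w])"
  shows "z = mink_cross u v"
proof -
  have eq: "mink_inner z w = mink_inner (mink_cross u v) w" for w
    by (simp add: assms mink_inner_cross)
  show ?thesis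
    using eq[of "axis 1 1"] eq[of "axis 2 1"] eq[of "axis 3 1"]
    by (simp add: vec_eq_iff forall_3 mink_inner_def axis_def)
qed

definition local_analytic_parametrization ::
    "(real ^ 3) set \<Rightarrow> (real \<times> real) set \<Rightarrow> (real \<times> real \<Rightarrow> real ^ 3) \<Rightarrow> bool"
  where "local_analytic_parametrization M U x \<longleftrightarrow>
    open U \<and> openin (top_of_set M) (x ` U) \<and> (\<exists>y. homeomorphism U (x ` U) x y) \<and>
    (\<forall>q\<in>U. real_analytic_at x q) \<and>
    (\<forall>q\<in>U. partial_u x q \<noteq> partial_v x q \<and> independent {partial_u x q, partial_v x q})"

definition regular_analytic_surface :: "(real ^ 3) set \<Rightarrow> bool"
  where "regular_analytic_surface M \<longleftrightarrow>
    (\<forall>p\<in>M. \<exists>U x. local_analytic_parametrization M U x \<and> p \<in> x ` U)"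

context
  fixes x :: "real \<times> real \<Rightarrow> real ^ 3"
begin

definition fund_E :: "real \<times> real \<Rightarrow> real"
  where "fund_E q = mink_inner (partial_u x q) (partial_u x q)"

definition fund_F :: "real \<times> real \<Rightarrow> real"
  where "fund_F q = mink_inner (partial_u x q) (partial_v x q)"

definition fund_G :: "real \<times> real \<Rightarrow> real"
  where "fund_G q = mink_inner (partial_v x q) (partial_v x q)"

definition fund_l :: "real \<times> real \<Rightarrow> real"
  where "fund_l q =
    mink_inner (mink_cross (partial_u x q) (partial_v x q)) (partial_u (partial_u x) q)"

definition fund_m :: "real \<times> real \<Rightarrow> real"
  where "fund_m q =
    mink_inner (mink_cross (partial_u x q) (partial_v x q)) (partial_v (partial_u x) q)"

definition fund_n :: "real \<times> real \<Rightarrow> real"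
  where "fund_n q =
    mink_inner (mink_cross (partial_u x q) (partial_v x q)) (partial_v (partial_v x) q)"

definition curv_a :: "real \<times> real \<Rightarrow> real"
  where "curv_a q = fund_F q * fund_n q - fund_G q * fund_m q"

definition curv_b :: "real \<times> real \<Rightarrow> real"
  where "curv_b q = fund_E q * fund_n q - fund_G q * fund_l q"

definition curv_c :: "real \<times> real \<Rightarrow> real"
  where "curv_c q = fund_E q * fund_m q - fund_F q * fund_l q"

definition principal_curvature_bde :: bde
  where "principal_curvature_bde = (curv_a, curv_b, curv_c)"

definition umbilic_at :: "real \<times> real \<Rightarrow> bool"
  where "umbilic_at q \<longleftrightarrow> curv_a q = 0 \<and> curv_b q = 0 \<and> curv_c q = 0"

text \<open>
  The point is the image of the origin, where the coefficients \<open>E\<close>, \<open>F\<close>, \<open>G\<close> do not all vanish.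
  Where several of the cases apply they agree: by the identity \<open>E a - F b + G c = 0\<close>
  (see \<open>curv_syzygy\<close>) the ideals of the three cases all equal \<open>\<langle>a, b, c\<rangle>\<close>.
\<close>

definition umbilic_multiplicity :: enat
  where "umbilic_multiplicity =
    (if fund_E (0, 0) \<noteq> 0 then real_multiplicity curv_b curv_c
     else if fund_F (0, 0) \<noteq> 0 then real_multiplicity curv_a curv_c
     else real_multiplicity curv_a curv_b)"

lemma curv_syzygy: "fund_E q * curv_a q - fund_F q * curv_b q + fund_G q * curv_c q = 0"
  by (simp add: curv_a_def curv_b_def curv_c_def algebra_simps)

end

end

theory Submission
  imports Defs
begin

text \<open>
  Let \<open>I\<close> be the ideal of the germ ring \<open>R\<close> generated by the complexified coefficients \<open>a, b, c\<close>. The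
  identity \<open>E a - F b + G c = 0\<close> and the fact that one of \<open>E\<close>, \<open>F\<close>, \<open>G\<close> is a unit
  (\<open>mink_no_isotropic_plane\<close>) show that two of the coefficients generate \<open>I\<close>, so that
  \<open>m\<^sub>u = dim R / I\<close>. The discriminant \<open>\<delta> = b\<^sup>2 - 4 a c\<close> lies in \<open>I\<^sup>2\<close>, its partial derivatives lie
  in \<open>I\<close>, and therefore \<open>\<phi> = a \<delta>\<^sub>u\<^sup>2 - b \<delta>\<^sub>u \<delta>\<^sub>v + c \<delta>\<^sub>v\<^sup>2\<close> lies in \<open>I\<^sup>3\<close>. The general inequality
  \<open>dim R / (f, g) \<ge> 2 * 3 * dim R / I\<close> for \<open>f \<in> I\<^sup>2\<close> and \<open>g \<in> I\<^sup>3\<close>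
  (\<open>intersection_multiplicity_ge_six\<close>), applied to \<open>\<delta>\<close> and \<open>\<phi>\<close> and halved, is the theorem.

  The inequality is a count in \<open>R / I\<^sup>4\<close> (\<open>colength_ge_six\<close>). With \<open>n = dim R / I\<close>, the ring
  \<open>R / I\<^sup>4\<close> has dimension at least \<open>(1 + 2 + 3 + 4) n\<close>, because the monomials in the two generators
  are independent over \<open>R / I\<close> in each degree (\<open>quasi_regular\<close>). The multiples of \<open>f\<close> span at most
  \<open>dim R / I\<^sup>2 \<le> 3 n\<close> dimensions in it, those of \<open>g\<close> at most \<open>n\<close>, and \<open>6 n\<close> dimensions are left.

  Quasi-regularity needs the two generators to have only trivial relations. This comes from finite
  colength (\<open>koszul_exact_germ\<close>): a power of each coordinate lies in \<open>I\<close>, and in the germ ring these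
  powers form a regular sequence because a germ that vanishes on the line \<open>u = 0\<close> is divisible by \<open>u\<close>.
  That division, like the holomorphy of partial derivatives, rests on Osgood's lemma
  (\<open>osgood_lemma\<close>): a bounded separately holomorphic function is holomorphic.
\<close>

section \<open>Powers of an ideal with two generators\<close>

text \<open>
  The \<open>n\<close>-th power of the ideal \<open>(b, c)\<close>. Since \<open>I\<^sup>n\<^sup>+\<^sup>1 = I\<^sup>n b + I\<^sup>n c\<close> for an ideal with generators
  \<open>b\<close>, \<open>c\<close>, the recursion avoids sums of products of arbitrary length.
\<close>

fun ideal_pow :: "'a::comm_ring_1 \<Rightarrow> 'a \<Rightarrow> nat \<Rightarrow> 'a set"
  where "ideal_pow b c 0 = UNIV"
  | "ideal_pow b c (Suc n) = {x * b + y * c | x y. x \<in> ideal_pow b c n \<and> y \<in> ideal_pow b c n}"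

lemma ideal_pow_add: "x \<in> ideal_pow b c n \<Longrightarrow> y \<in> ideal_pow b c n \<Longrightarrow> x + y \<in> ideal_pow b c n"
proof (induction n arbitrary: x y)
  case (Suc n)
  then obtain x1 x2 y1 y2 where *: "x = x1 * b + x2 * c" "y = y1 * b + y2 * c"
    "x1 \<in> ideal_pow b c n" "x2 \<in> ideal_pow b c n" "y1 \<in> ideal_pow b c n" "y2 \<in> ideal_pow b c n" by auto
  have "x + y = (x1 + y1) * b + (x2 + y2) * c" by (simp add: * algebra_simps)
  with * Suc.IH show ?case by auto
qed simp

lemma ideal_pow_mult: "x \<in> ideal_pow b c n \<Longrightarrow> r * x \<in> ideal_pow b c n"
proof (induction n arbitrary: x)
  case (Suc n)
  then obtain x1 x2 where *: "x = x1 * b + x2 * c"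
    "x1 \<in> ideal_pow b c n" "x2 \<in> ideal_pow b c n" by auto
  have "r * x = (r * x1) * b + (r * x2) * c" by (simp add: * algebra_simps)
  with * Suc.IH show ?case by auto
qed simp

lemma ideal_pow_zero: "0 \<in> ideal_pow b c n"
  by (induction n) (auto intro!: exI[of _ 0])

lemma ideal_pow_diff: "x \<in> ideal_pow b c n \<Longrightarrow> y \<in> ideal_pow b c n \<Longrightarrow> x - y \<in> ideal_pow b c n"
  using ideal_pow_add[of x b c n "(-1) * y"] ideal_pow_mult[of y b c n "-1"] by simp

lemma ideal_pow_sum: "(\<And>i. i \<in> A \<Longrightarrow> f i \<in> ideal_pow b c n) \<Longrightarrow> sum f A \<in> ideal_pow b c n"
  by (induction A rule: infinite_finite_induct) (auto intro: ideal_pow_add ideal_pow_zero)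

lemma ideal_pow_SucI:
  assumes "x \<in> ideal_pow b c n"
  shows "x * b \<in> ideal_pow b c (Suc n)" "x * c \<in> ideal_pow b c (Suc n)"
proof -
  have "x * b = x * b + 0 * c" "x * c = 0 * b + x * c" by simp_all
  then show "x * b \<in> ideal_pow b c (Suc n)" "x * c \<in> ideal_pow b c (Suc n)"
    using ideal_pow_zero[of b c n] assms unfolding ideal_pow.simps by blast+
qed

lemma ideal_pow_prod:
  "x \<in> ideal_pow b c m \<Longrightarrow> y \<in> ideal_pow b c n \<Longrightarrow> x * y \<in> ideal_pow b c (m + n)"
proof (induction m arbitrary: x)
  case (Suc m)
  then obtain x1 x2 where *: "x = x1 * b + x2 * c"
    "x1 \<in> ideal_pow b c m" "x2 \<in> ideal_pow b c m" by auto
  have "x * y = (x1 * y) * b + (x2 * y) * c" by (simp add: * algebra_simps)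
  moreover have "x1 * y \<in> ideal_pow b c (m + n)" "x2 * y \<in> ideal_pow b c (m + n)"
    using * Suc.IH Suc.prems(2) by auto
  ultimately show ?case by auto
qed (simp add: ideal_pow_mult)

lemma ideal_pow_Suc_subset: "ideal_pow b c (Suc n) \<subseteq> ideal_pow b c n"
proof
  fix x assume "x \<in> ideal_pow b c (Suc n)"
  then obtain y z where "x = b * y + c * z" "y \<in> ideal_pow b c n" "z \<in> ideal_pow b c n"
    by (auto simp: mult.commute)
  then show "x \<in> ideal_pow b c n" by (simp add: ideal_pow_add ideal_pow_mult)
qed

lemma ideal_pow_antimono: "m \<le> n \<Longrightarrow> ideal_pow b c n \<subseteq> ideal_pow b c m"
  by (rule lift_Suc_antimono_le[where f = "ideal_pow b c"]) (rule ideal_pow_Suc_subset)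

lemma monomial_in_ideal_pow: "b ^ i * c ^ j \<in> ideal_pow b c (i + j)"
proof -
  have b: "b ^ i \<in> ideal_pow b c i" for i
    by (induction i) (simp_all only: power_Suc2 ideal_pow_SucI(1) power_0 ideal_pow.simps(1) UNIV_I)
  have c: "c ^ i \<in> ideal_pow b c i" for i
    by (induction i) (simp_all only: power_Suc2 ideal_pow_SucI(2) power_0 ideal_pow.simps(1) UNIV_I)
  show ?thesis by (rule ideal_pow_prod[OF b c])
qed

text \<open>
  The coefficients are arbitrary ring elements, hence not unique; that they are unique modulo \<open>I\<close>
  is the quasi-regularity proved below.
\<close>

lemma ideal_pow_form:
  "x \<in> ideal_pow b c n \<Longrightarrow> \<exists>s. x = (\<Sum>j\<le>n. s j * (b ^ j * c ^ (n - j)))"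
proof (induction n arbitrary: x)
  case (Suc n)
  then obtain y z where *: "x = y * b + z * c"
    "y \<in> ideal_pow b c n" "z \<in> ideal_pow b c n" by auto
  then obtain s t where s: "y = (\<Sum>j\<le>n. s j * (b ^ j * c ^ (n - j)))"
    and t: "z = (\<Sum>j\<le>n. t j * (b ^ j * c ^ (n - j)))" using Suc.IH by blast
  define r where "r j = (if j = 0 then 0 else s (j - 1)) + (if j \<le> n then t j else 0)" for j
  have "(\<Sum>j\<le>Suc n. r j * (b ^ j * c ^ (Suc n - j))) =
     (\<Sum>j\<le>Suc n. (if j = 0 then 0 else s (j - 1)) * (b ^ j * c ^ (Suc n - j))) +
     (\<Sum>j\<le>Suc n. (if j \<le> n then t j else 0) * (b ^ j * c ^ (Suc n - j)))"
    by (simp only: r_def distrib_right sum.distrib)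
  also have "(\<Sum>j\<le>Suc n. (if j = 0 then 0 else s (j - 1)) * (b ^ j * c ^ (Suc n - j))) = y * b"
    by (subst sum.atMost_Suc_shift) (simp add: s sum_distrib_right sum_distrib_left mult_ac)
  also have "(\<Sum>j\<le>Suc n. (if j \<le> n then t j else 0) * (b ^ j * c ^ (Suc n - j))) = z * c"
    by (simp add: t sum_distrib_right sum_distrib_left Suc_diff_le mult_ac)
  finally show ?case unfolding * by metis
next
  case 0
  show ?case by (rule exI[of _ "\<lambda>_. x"]) simp
qed

section \<open>Exactness of the Koszul complex and quasi-regularity\<close>

text \<open>
  The only relations between \<open>b\<close> and \<open>c\<close> are the trivial ones, that is, the Koszul complex of
  \<open>(b, c)\<close> has no first homology. For non-units in a Noetherian local ring this means that
  \<open>b, c\<close> is a regular sequence; unlike regularity, the condition is symmetric in \<open>b\<close> and \<open>c\<close>.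
\<close>

definition koszul_exact :: "'a::comm_ring_1 \<Rightarrow> 'a \<Rightarrow> bool"
  where "koszul_exact b c \<longleftrightarrow> (\<forall>x y. x * b + y * c = 0 \<longrightarrow> (\<exists>t. x = t * c \<and> y = - (t * b)))"

text \<open>
  Exactness passes from \<open>(b, c)\<close> to \<open>(b\<^sup>n, c)\<close>: peel off one factor \<open>b\<close> at a time.
\<close>

lemma koszul_exact_power:
  assumes "koszul_exact b c"
  shows "r * b ^ n + x * c = 0 \<Longrightarrow> \<exists>t. r = t * c \<and> x = - (t * b ^ n)"
proof (induction n arbitrary: x)
  case 0
  then show ?case by (intro exI[of _ "-x"]) (simp add: eq_neg_iff_add_eq_0)
next
  case (Suc n)
  then have "(r * b ^ n) * b + x * c = 0" by (simp add: mult_ac)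
  with assms obtain t where t: "r * b ^ n = t * c" "x = - (t * b)" unfolding koszul_exact_def by metis
  from t(1) have "r * b ^ n + (- t) * c = 0" by simp
  from Suc.IH[OF this] obtain t' where "r = t' * c" "t = t' * b ^ n" by auto
  with t show ?case by (intro exI[of _ t']) (simp add: mult_ac)
qed

text \<open>
  In a form of degree \<open>n\<close> all monomials except \<open>b\<^sup>n\<close> are divisible by \<open>c\<close>. If the form vanishes,
  the resulting relation between \<open>b\<^sup>n\<close> and \<open>c\<close> is trivial, with a witness \<open>t\<close>: the last
  coefficient is \<open>t c\<close>, and the other terms divided by \<open>c\<close> add up to \<open>- t b\<^sup>n\<close>. Adding
  \<open>t b\<close> to the preceding coefficient thus gives a vanishing form of degree \<open>n - 1\<close>.
\<close>

lemma quasi_regular_zero: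
  assumes "koszul_exact b c"
  shows "(\<Sum>j\<le>n. r j * (b ^ j * c ^ (n - j))) = 0 \<Longrightarrow> j \<le> n \<Longrightarrow> r j \<in> ideal_pow b c 1"
proof (induction n arbitrary: r j)
  case 0
  then show ?case using ideal_pow_zero[of b c 1] by simp
next
  case (Suc n)
  define Y where "Y = (\<Sum>j\<le>n. r j * (b ^ j * c ^ (n - j)))"
  have "(\<Sum>j\<le>Suc n. r j * (b ^ j * c ^ (Suc n - j))) = r (Suc n) * b ^ Suc n + Y * c"
    by (simp add: Y_def sum_distrib_right sum_distrib_left Suc_diff_le mult_ac)
  with Suc.prems have "r (Suc n) * b ^ Suc n + Y * c = 0" by simp
  from koszul_exact_power[OF assms this] obtain t
    where t: "r (Suc n) = t * c" "Y = - (t * b ^ Suc n)" by auto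
  have tI: "t * c \<in> ideal_pow b c 1" "t * b \<in> ideal_pow b c 1"
    using ideal_pow_SucI[of t b c 0] by simp_all
  define r' where "r' i = (if i = n then r n + t * b else r i)" for i
  have "(\<Sum>j\<le>n. r' j * (b ^ j * c ^ (n - j))) =
      (\<Sum>j\<le>n. r j * (b ^ j * c ^ (n - j)) + (if j = n then t * b * b ^ n else 0))"
    by (rule sum.cong) (auto simp: r'_def algebra_simps)
  also have "\<dots> = 0" using t(2) by (simp add: sum.distrib Y_def[symmetric] mult_ac)
  finally have IH: "j \<le> n \<Longrightarrow> r' j \<in> ideal_pow b c 1" for j using Suc.IH by blast
  show ?case
  proof (cases "j \<le> n")
    case True
    have "(if j = n then t * b else 0) \<in> ideal_pow b c 1"
      by (simp only: tI ideal_pow_zero split: if_split) simp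
    from ideal_pow_diff[OF IH[OF True] this] show ?thesis by (simp only: r'_def split: if_splits) simp_all
  next
    case False
    then show ?thesis using Suc.prems t tI by (simp add: le_Suc_eq)
  qed
qed

text \<open>
  Quasi-regularity: the monomials of degree \<open>n\<close> form a basis of \<open>I\<^sup>n / I\<^sup>n\<^sup>+\<^sup>1\<close> over \<open>R / I\<close>. An element
  of \<open>I\<^sup>n\<^sup>+\<^sup>1\<close> is a form of degree \<open>n\<close> with coefficients in \<open>I\<close>, so it can be absorbed into the
  coefficients, which reduces the claim to forms that vanish.
\<close>

lemma quasi_regular:
  assumes "koszul_exact b c"
    and "(\<Sum>j\<le>n. r j * (b ^ j * c ^ (n - j))) \<in> ideal_pow b c (Suc n)" and "j \<le> n"
  shows "r j \<in> ideal_pow b c 1"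
proof -
  from assms(2) obtain y z where *: "(\<Sum>j\<le>n. r j * (b ^ j * c ^ (n - j))) = y * b + z * c"
    "y \<in> ideal_pow b c n" "z \<in> ideal_pow b c n" by auto
  then obtain s t where s: "y = (\<Sum>j\<le>n. s j * (b ^ j * c ^ (n - j)))"
    and t: "z = (\<Sum>j\<le>n. t j * (b ^ j * c ^ (n - j)))" using ideal_pow_form by metis
  have "(\<Sum>j\<le>n. (r j - s j * b - t j * c) * (b ^ j * c ^ (n - j))) = 0"
  proof -
    have "(r j - s j * b - t j * c) * (b ^ j * c ^ (n - j)) = r j * (b ^ j * c ^ (n - j)) -
        s j * (b ^ j * c ^ (n - j)) * b - t j * (b ^ j * c ^ (n - j)) * c" for j
      by (simp add: algebra_simps)
    then show ?thesis
      using *(1) by (simp only: sum_subtractf sum_distrib_right[symmetric] s[symmetric] t[symmetric]) simp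
  qed
  from quasi_regular_zero[OF assms(1) this assms(3)]
  have "(r j - s j * b - t j * c) \<in> ideal_pow b c 1" .
  moreover have "s j * b + t j * c \<in> ideal_pow b c 1" by auto
  ultimately have "(r j - s j * b - t j * c) + (s j * b + t j * c) \<in> ideal_pow b c 1"
    by (rule ideal_pow_add)
  then show ?thesis by (simp add: algebra_simps)
qed

text \<open>
  Grade sensitivity of the Koszul complex in its simplest case: an ideal \<open>(b, c)\<close> that contains a
  regular sequence \<open>u, v\<close> has an exact Koszul complex. Writing \<open>u = p b + q c\<close> and
  \<open>v = r b + s c\<close>, a relation \<open>(x, y)\<close> becomes trivial after multiplication by \<open>u\<close> (witness \<open>w\<close>)
  and by \<open>v\<close> (witness \<open>z\<close>). The witnesses satisfy \<open>v w = u z\<close>, so \<open>u\<close> divides \<open>w\<close>, and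
  \<open>w / u\<close> is a witness for the relation itself.
\<close>

lemma koszul_exact_if_contains_regular:
  fixes u v b c :: "'a::comm_ring_1"
  assumes u: "\<And>x. u * x = 0 \<Longrightarrow> x = 0" 
    and uv: "\<And>x. u dvd v * x \<Longrightarrow> u dvd x"
    and U: "u \<in> ideal_pow b c 1" and V: "v \<in> ideal_pow b c 1"
  shows "koszul_exact b c"
  unfolding koszul_exact_def
proof (intro allI impI)
  fix x y assume xy: "x * b + y * c = 0"
  have cancel: "r = s" if "u * r = u * s" for r s
    using u[of "r - s"] that by (simp add: right_diff_distrib)
  from U V obtain p q r s where p: "u = p * b + q * c" and r: "v = r * b + s * c" by auto
  define w where "w = q * x - p * y"
  define z where "z = s * x - r * y"
  have yc: "y * c = - (x * b)" using xy by (simp add: eq_neg_iff_add_eq_0 add.commute)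
  have w: "c * w = u * x" "b * w = - (u * y)" 
  proof -
    have "c * w = q * c * x - p * (y * c)" by (simp add: w_def algebra_simps)
    also have "\<dots> = u * x" unfolding yc by (simp add: p algebra_simps)
    finally show "c * w = u * x" .
    have "b * w = q * (x * b) - p * b * y" by (simp add: w_def algebra_simps)
    also have "x * b = - (y * c)" using yc by simp
    also have "q * - (y * c) - p * b * y = - (u * y)" by (simp add: p algebra_simps)
    finally show "b * w = - (u * y)" .
  qed
  have z: "c * z = v * x" "b * z = - (v * y)" 
  proof -
    have "c * z = s * c * x - r * (y * c)" by (simp add: z_def algebra_simps)
    also have "\<dots> = v * x" unfolding yc by (simp add: r algebra_simps)
    finally show "c * z = v * x" .
    have "b * z = s * (x * b) - r * b * y" by (simp add: z_def algebra_simps)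
    also have "x * b = - (y * c)" using yc by simp
    also have "s * - (y * c) - r * b * y = - (v * y)" by (simp add: r algebra_simps)
    finally show "b * z = - (v * y)" .
  qed
  \<comment> \<open>The difference is annihilated by \<open>b\<close> and by \<open>c\<close>, hence by \<open>u\<close>, which is cancellable.\<close>
  have "u * (v * w - u * z) = p * (v * (b * w) - u * (b * z)) + q * (v * (c * w) - u * (c * z))"
    by (subst (1) p) (simp add: algebra_simps)
  also have "\<dots> = 0" by (simp add: w z algebra_simps)
  finally have "v * w = u * z" using u by (metis right_minus_eq)
  then have "u dvd w" using uv by (metis dvd_triv_left)
  then obtain t where t: "w = u * t" ..
  have "x = t * c" "y = - (t * b)"
    using w cancel[of x "t * c"] cancel[of y "- (t * b)"] unfolding t by (simp_all add: algebra_simps)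
  then show "\<exists>t. x = t * c \<and> y = - (t * b)" by blast
qed

text \<open>
  If \<open>u, v\<close> is a regular sequence, so is \<open>u\<^sup>m, v\<^sup>n\<close>.
\<close>

lemma coprime_powers_regular:
  fixes u v :: "'a::comm_ring_1"
  assumes u: "\<And>x. u * x = 0 \<Longrightarrow> x = 0" and uv: "\<And>x. u dvd v * x \<Longrightarrow> u dvd x"
  shows "u ^ m * x = 0 \<Longrightarrow> x = 0" and "u ^ m dvd v ^ n * x \<Longrightarrow> u ^ m dvd x"
proof -
  show "u ^ m * x = 0 \<Longrightarrow> x = 0" by (induction m) (auto simp: mult.assoc dest: u)
  have 1: "u ^ m dvd v * x \<Longrightarrow> u ^ m dvd x" for x
  proof (induction m arbitrary: x)
    case (Suc m)
    then obtain t where t: "v * x = u * (u ^ m * t)" by (auto simp: mult.assoc elim: dvdE)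
    then have "u dvd x" using uv by (metis dvd_triv_left)
    then obtain y where y: "x = u * y" ..
    have "u * (v * y - u ^ m * t) = 0" using t by (simp add: y algebra_simps)
    then have "v * y = u ^ m * t" using u by (metis right_minus_eq)
    then have "u ^ m dvd y" using Suc.IH by simp
    then show ?case by (simp add: y mult_dvd_mono)
  qed simp
  show "u ^ m dvd v ^ n * x \<Longrightarrow> u ^ m dvd x"
    by (induction n) (auto simp: mult.assoc dest: 1)
qed

section \<open>Dimension counts modulo powers of an ideal\<close>

locale field_algebra = vector_space scale
  for scale :: "'k::field \<Rightarrow> 'a::comm_ring_1 \<Rightarrow> 'a" +
  assumes scale_mult: "scale k (x * y) = scale k x * y"
begin

lemma mult_scale: "x * scale k y = scale k (x * y)"
  using scale_mult[of k y x] by (simp add: mult.commute)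

lemma scale_in_ideal_pow: "x \<in> ideal_pow b c n \<Longrightarrow> scale k x \<in> ideal_pow b c n"
  using ideal_pow_mult[of x b c n "scale k 1"] by (simp flip: scale_mult)

lemma card_le_of_independent_family:
  assumes "finite A" "finite T" "s ` A \<subseteq> span T"
    and "\<And>k a. (\<Sum>a\<in>A. scale (k a) (s a)) = 0 \<Longrightarrow> a \<in> A \<Longrightarrow> k a = 0"
  shows "card A \<le> card T"
proof -
  have inj: "inj_on s A"
  proof (rule inj_onI, rule ccontr)
    fix a a' assume a: "a \<in> A" "a' \<in> A" "s a = s a'" "a \<noteq> a'"
    define k where "k = (\<lambda>x. (if x = a then 1 else 0) - (if x = a' then 1 else (0::'k)))"
    have "(\<Sum>x\<in>A. scale (k x) (s x)) = (\<Sum>x\<in>A. (if x = a then s a else 0) - (if x = a' then s a' else 0))"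
      by (rule sum.cong) (auto simp: k_def scale_left_diff_distrib)
    also have "\<dots> = 0" using a assms(1) by (simp add: sum_subtractf)
    finally have "k a = 0" using assms(4) a by blast
    then show False using a by (simp add: k_def)
  qed
  have "independent (s ` A)"
  proof (rule independent_if_scalars_zero)
    fix f x assume "(\<Sum>x\<in>s ` A. scale (f x) x) = 0" "x \<in> s ` A"
    then show "f x = 0" using assms(4)[of "f \<circ> s"] by (auto simp: sum.reindex[OF inj])
  qed (use assms in auto)
  from independent_span_bound[OF assms(2) this assms(3)] show ?thesis
    by (simp add: card_image[OF inj])
qed

text \<open>
  Steinitz exchange in the quotient by a subspace \<open>W\<close>, expressed with representatives, so that no
  quotient space has to be formed: representatives of independent classes that lie in \<open>span T\<close> are
  themselves independent.
\<close>

lemma card_le_of_independent_mod: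
  assumes "finite A" "finite T" and W: "subspace W"
    and span: "\<And>a. a \<in> A \<Longrightarrow> \<exists>t\<in>span T. s a - t \<in> W"
    and ind: "\<And>k a. (\<Sum>a\<in>A. scale (k a) (s a)) \<in> W \<Longrightarrow> a \<in> A \<Longrightarrow> k a = 0"
  shows "card A \<le> card T"
proof -
  from span obtain t where t: "\<And>a. a \<in> A \<Longrightarrow> t a \<in> span T" "\<And>a. a \<in> A \<Longrightarrow> s a - t a \<in> W" by metis
  show ?thesis
  proof (rule card_le_of_independent_family[OF assms(1,2), of t])
    fix k a assume *: "(\<Sum>a\<in>A. scale (k a) (t a)) = 0" "a \<in> A"
    have "(\<Sum>a\<in>A. scale (k a) (s a)) = (\<Sum>a\<in>A. scale (k a) (s a - t a)) + (\<Sum>a\<in>A. scale (k a) (t a))"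
      by (simp add: scale_right_diff_distrib sum_subtractf)
    also have "\<dots> = (\<Sum>a\<in>A. scale (k a) (s a - t a))" using * by simp
    also have "\<dots> \<in> W" by (intro subspace_sum[OF W] subspace_scale[OF W] t)
    finally show "k a = 0" using ind * by blast
  qed (use t in auto)
qed

lemma subspace_ideal_pow: "subspace (ideal_pow b c n)"
  by (auto simp: subspace_def intro: ideal_pow_zero ideal_pow_add scale_in_ideal_pow)

text \<open>
  The classes of \<open>e 0, \<dots>, e (n - 1)\<close> form a basis of the quotient by \<open>I\<close>.
\<close>

definition basis_mod :: "nat \<Rightarrow> (nat \<Rightarrow> 'a) \<Rightarrow> 'a set \<Rightarrow> bool"
  where "basis_mod n e I \<longleftrightarrow> (\<forall>f. \<exists>k. f - (\<Sum>i<n. scale (k i) (e i)) \<in> I) \<and>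
     (\<forall>k. (\<Sum>i<n. scale (k i) (e i)) \<in> I \<longrightarrow> (\<forall>i<n. k i = 0))"

text \<open>
  A basis of \<open>R / I\<close> multiplied by all monomials of degree less than \<open>N\<close> stays independent modulo
  \<open>I\<^sup>N\<close>; for \<open>N = 4\<close> this is the bound \<open>dim R / I\<^sup>4 \<ge> 10 dim R / I\<close>. In a vanishing combination
  consider the part of lowest degree \<open>m\<close>: it lies in \<open>I\<^sup>m\<^sup>+\<^sup>1\<close>, so by quasi-regularity its
  coefficients lie in \<open>I\<close>, and they are combinations of the basis of \<open>R / I\<close>.
\<close>

lemma independent_mod_ideal_pow:
  assumes K: "koszul_exact b c" and e: "basis_mod n e (ideal_pow b c 1)"
    and 0: "(\<Sum>m<N. \<Sum>j\<le>m. (\<Sum>i<n. scale (k m j i) (e i)) * (b ^ j * c ^ (m - j))) \<in> ideal_pow b c N"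
  shows "m < N \<Longrightarrow> j \<le> m \<Longrightarrow> i < n \<Longrightarrow> k m j i = 0"
proof (induction m arbitrary: j i rule: less_induct)
  case (less m)
  define r where "r m j = (\<Sum>i<n. scale (k m j i) (e i))" for m j
  define H where "H m = (\<Sum>j\<le>m. r m j * (b ^ j * c ^ (m - j)))" for m
  have low: "H l = 0" if "l < m" for l
    using less that by (simp add: H_def r_def)
  have high: "H l \<in> ideal_pow b c (Suc m)" if "l > m" for l
  proof -
    have "H l \<in> ideal_pow b c l"
      unfolding H_def
    proof (rule ideal_pow_sum, rule ideal_pow_mult)
      fix j assume "j \<in> {..l}"
      then show "b ^ j * c ^ (l - j) \<in> ideal_pow b c l"
        using monomial_in_ideal_pow[of b j c "l - j"] by simp
    qed
    then show ?thesis using that ideal_pow_antimono[of "Suc m" l b c] by (meson Suc_leI subsetD)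
  qed
  have "(\<Sum>l<N. H l) = H m + (\<Sum>l\<in>{..<N}-{m}. H l)"
    using less.prems by (subst sum.remove[of _ m]) auto
  then have "H m = (\<Sum>l<N. H l) - (\<Sum>l\<in>{..<N}-{m}. H l)" by simp
  also have "\<dots> \<in> ideal_pow b c (Suc m)"
  proof (rule ideal_pow_diff, goal_cases)
    case 1
    show "(\<Sum>l<N. H l) \<in> ideal_pow b c (Suc m)"
      unfolding H_def r_def by (rule subsetD[OF ideal_pow_antimono 0]) (use less.prems in simp)
  next
    case 2
    have "H l \<in> ideal_pow b c (Suc m)" if "l \<in> {..<N} - {m}" for l
      using that low high[of l] ideal_pow_zero[of b c "Suc m"]
      by (cases "l < m") (auto simp del: ideal_pow.simps(2))
    then show ?case by (rule ideal_pow_sum)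
  qed
  finally have "r m j \<in> ideal_pow b c 1" using quasi_regular[OF K _ less.prems(2)] unfolding H_def by blast
  then show ?case using e less.prems unfolding basis_mod_def r_def by blast
qed

text \<open>
  The multiplicity inequality behind the theorem, in the form \<open>dim R / (f, g) \<ge> 2 * 3 * dim R / I\<close>
  for \<open>f \<in> I\<^sup>2\<close> and \<open>g \<in> I\<^sup>3\<close>. Modulo \<open>I\<^sup>4\<close> the multiple \<open>x f\<close> depends only on \<open>x\<close> modulo
  \<open>I\<^sup>2\<close>, and \<open>y g\<close> only on \<open>y\<close> modulo \<open>I\<close>. Hence the image of \<open>(f, g)\<close> in \<open>R / I\<^sup>4\<close> has dimension
  at most \<open>dim R / I\<^sup>2 + dim R / I \<le> (3 + 1) n\<close>, while \<open>R / I\<^sup>4\<close> has dimension at least \<open>10 n\<close>.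
  The exponent \<open>4\<close> is chosen so that this crude count, which ignores the overlap of the multiples of
  \<open>f\<close> and of \<open>g\<close>, already gives the exact constant.
\<close>

theorem colength_ge_six:
  assumes K: "koszul_exact b c" and e: "basis_mod n e (ideal_pow b c 1)"
    and f: "f \<in> ideal_pow b c 2" and g: "g \<in> ideal_pow b c 3"
    and e': "\<And>x. \<exists>k. x - (\<Sum>i<d. scale (k i) (e' i)) \<in> ideal_pow f g 1"
  shows "6 * n \<le> d"
proof -
  define W where "W = ideal_pow b c 4"
  define E where "E = e ` {..<n}"
  define T where "T = e' ` {..<d} \<union> ((*) f ` E \<union> (*) (f * b) ` E \<union> (*) (f * c) ` E \<union> (*) g ` E)"
  have finE: "finite E" "card E \<le> n" unfolding E_def using card_image_le[of "{..<n}" e] by auto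
  have finT: "finite T" unfolding T_def using finE by simp
  have "card T \<le> d + (n + n + n + n)"
    unfolding T_def
    by (intro order_trans[OF card_Un_le] add_mono order_trans[OF card_image_le])
       (use finE in auto)
  then have cardT: "card T \<le> d + 4 * n" by simp
  have sW: "subspace W" unfolding W_def by (rule subspace_ideal_pow)
  have Espan: "\<exists>t\<in>span E. \<exists>y z. x = t + y * b + z * c" for x
  proof -
    from e obtain k where "x - (\<Sum>i<n. scale (k i) (e i)) \<in> ideal_pow b c 1" unfolding basis_mod_def by blast
    then obtain y z where "x - (\<Sum>i<n. scale (k i) (e i)) = y * b + z * c" by auto
    then have "x = (\<Sum>i<n. scale (k i) (e i)) + y * b + z * c" by (simp add: algebra_simps)
    moreover have "(\<Sum>i<n. scale (k i) (e i)) \<in> span E"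
      by (intro span_sum span_scale span_base) (auto simp: E_def)
    ultimately show ?thesis by blast
  qed
  have mul: "h * t \<in> span ((*) h ` E)" if "t \<in> span E" for h t
  proof -
    show ?thesis using that
    proof (rule span_induct)
      show "subspace {t. h * t \<in> span ((*) h ` E)}"
        by (auto simp: subspace_def distrib_left mult_scale intro: span_zero span_add span_scale)
    qed (auto intro: span_base)
  qed
  have mulT: "h * t \<in> span T" if "t \<in> span E" "(*) h ` E \<subseteq> T" for h t
    using mul[OF that(1)] span_mono[OF that(2)] by blast
  have T: "(*) f ` E \<subseteq> T" "(*) (f * b) ` E \<subseteq> T" "(*) (f * c) ` E \<subseteq> T" "(*) g ` E \<subseteq> T"
    unfolding T_def by auto
  have fW: "f * x \<in> W" if "x \<in> ideal_pow b c 2" for x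
    using ideal_pow_prod[OF f that] by (simp add: W_def)
  have gW: "g * x \<in> W" if "x \<in> ideal_pow b c 1" for x
    using ideal_pow_prod[OF g that] by (simp add: W_def)
  \<comment> \<open>Coefficients of \<open>f\<close> are expanded modulo \<open>I\<^sup>2\<close>, those of \<open>g\<close> modulo \<open>I\<close>.\<close>
  have all: "\<exists>t\<in>span T. x - t \<in> W" for x
  proof -
    obtain k where "x - (\<Sum>i<d. scale (k i) (e' i)) \<in> ideal_pow f g 1" using e' by blast
    then obtain p q where pq: "x - (\<Sum>i<d. scale (k i) (e' i)) = p * f + q * g" by auto
    obtain t0 y z where p: "t0 \<in> span E" "p = t0 + y * b + z * c" using Espan by blast
    obtain t1 y1 z1 where y: "t1 \<in> span E" "y = t1 + y1 * b + z1 * c" using Espan by blast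
    obtain t2 y2 z2 where z: "t2 \<in> span E" "z = t2 + y2 * b + z2 * c" using Espan by blast
    obtain t3 y3 z3 where q: "t3 \<in> span E" "q = t3 + y3 * b + z3 * c" using Espan by blast
    define t where "t = (\<Sum>i<d. scale (k i) (e' i)) + (f * t0 + (f * b) * t1 + (f * c) * t2 + g * t3)"
    have "t \<in> span T"
      unfolding t_def
      by (intro span_add span_sum span_scale mulT T p(1) y(1) z(1) q(1))
         (auto simp: T_def intro: span_base)
    moreover have "x - t = f * ((y1 * b + z1 * c) * b + (y2 * b + z2 * c) * c) + g * (y3 * b + z3 * c)"
    proof -
      have "x = (\<Sum>i<d. scale (k i) (e' i)) + (p * f + q * g)" using pq by (simp add: algebra_simps)
      then show ?thesis unfolding t_def by (simp add: p(2) y(2) z(2) q(2) algebra_simps)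
    qed
    moreover have "\<dots> \<in> W"
    proof -
      have 1: "x * b + y * c \<in> ideal_pow b c 1" for x y by auto
      have "(y1 * b + z1 * c) * b + (y2 * b + z2 * c) * c \<in> ideal_pow b c (Suc 1)"
        unfolding ideal_pow.simps(2)[of b c 1] using 1 by blast
      then have "f * ((y1 * b + z1 * c) * b + (y2 * b + z2 * c) * c) \<in> W"
        by (intro fW) (simp only: numeral_2_eq_2 One_nat_def)
      moreover have "g * (y3 * b + z3 * c) \<in> W" by (rule gW[OF 1])
      ultimately show ?thesis unfolding W_def by (rule ideal_pow_add)
    qed
    ultimately show ?thesis by metis
  qed
  \<comment> \<open>Indices \<open>(m, j, i)\<close> of the products \<open>e i b\<^sup>j c\<^sup>m\<^sup>-\<^sup>j\<close> of degree \<open>m < 4\<close>: there are \<open>1 + 2 + 3 + 4\<close> monomials.\<close>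
  define A where "A = (SIGMA m:{..<4::nat}. {..m} \<times> {..<n})"
  have "card A = (\<Sum>m<4. Suc m * n)" by (simp add: A_def card_cartesian_product)
  also have "\<dots> = 10 * n" by (simp add: eval_nat_numeral)
  finally have cardA: "card A = 10 * n" .
  have "card A \<le> card T"
  proof (rule card_le_of_independent_mod[OF _ finT sW,
        where s = "\<lambda>(m, j, i). e i * (b ^ j * c ^ (m - j))"])
    show "finite A" by (auto simp: A_def)
    show "\<exists>t\<in>span T. (case a of (m, j, i) \<Rightarrow> e i * (b ^ j * c ^ (m - j))) - t \<in> W" for a
      by (rule all)
    fix k a
    assume *: "(\<Sum>a\<in>A. scale (k a) (case a of (m, j, i) \<Rightarrow> e i * (b ^ j * c ^ (m - j)))) \<in> W" "a \<in> A"
    have "(\<Sum>a\<in>A. scale (k a) (case a of (m, j, i) \<Rightarrow> e i * (b ^ j * c ^ (m - j)))) =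
       (\<Sum>m<4. \<Sum>j\<le>m. (\<Sum>i<n. scale (k (m, j, i)) (e i)) * (b ^ j * c ^ (m - j)))"
    proof -
      have "(\<Sum>m<4. \<Sum>j\<le>m. (\<Sum>i<n. scale (k (m, j, i)) (e i)) * (b ^ j * c ^ (m - j))) =
          (\<Sum>m<4. \<Sum>x\<in>{..m} \<times> {..<n}. scale (k (m, x)) (e (snd x)) * (b ^ fst x * c ^ (m - fst x)))"
        by (simp add: sum_distrib_right sum.cartesian_product case_prod_unfold)
      also have "\<dots> = (\<Sum>a\<in>A. scale (k a) (e (snd (snd a))) * (b ^ fst (snd a) * c ^ (fst a - fst (snd a))))"
        unfolding A_def by (subst sum.Sigma) (auto simp: case_prod_unfold)
      finally show ?thesis by (simp add: scale_mult case_prod_unfold)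
    qed
    with * have "(\<Sum>m<4. \<Sum>j\<le>m. (\<Sum>i<n. scale (k (m, j, i)) (e i)) * (b ^ j * c ^ (m - j))) \<in> ideal_pow b c 4"
      by (simp add: W_def)
    from independent_mod_ideal_pow[OF K e this] *(2) show "k a = 0" by (auto simp: A_def)
  qed
  with cardA cardT show ?thesis by simp
qed

text \<open>
  In a quotient of finite dimension the powers of \<open>x\<close> are dependent. The lowest term of a dependence
  relation gives \<open>x\<^sup>N\<close> times a unit in the ideal, when nonzero constants plus multiples of \<open>x\<close> are
  units.
\<close>

lemma power_in_ideal:
  fixes n :: nat
  assumes span: "\<And>f. \<exists>k. f - (\<Sum>i<n. scale (k i) (e i)) \<in> ideal_pow b c 1"
    and unit: "\<And>k y. k \<noteq> 0 \<Longrightarrow> (scale k 1 + x * y) dvd 1"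
  shows "\<exists>N. x ^ N \<in> ideal_pow b c 1"
proof -
  let ?I = "ideal_pow b c 1"
  have "\<exists>k (i::nat). (\<Sum>i\<in>{..n}. scale (k i) (x ^ i)) \<in> ?I \<and> i \<le> n \<and> k i \<noteq> 0"
  proof (rule ccontr)
    assume neg: "\<not> ?thesis"
    have "card {..n} \<le> card (e ` {..<n})"
    proof (rule card_le_of_independent_mod[where W = ?I and s = "\<lambda>i. x ^ i"])
      show "\<exists>t\<in>span (e ` {..<n}). x ^ a - t \<in> ?I" for a
      proof -
        obtain k where "x ^ a - (\<Sum>i<n. scale (k i) (e i)) \<in> ?I" using span by blast
        moreover have "(\<Sum>i<n. scale (k i) (e i)) \<in> module.span scale (e ` {..<n})"
          by (intro span_sum span_scale span_base) auto
        ultimately show ?thesis by blast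
      qed
      show "subspace ?I" by (rule subspace_ideal_pow)
    qed (use neg in auto)
    also have "\<dots> \<le> n" using card_image_le[of "{..<n}" e] by simp
    finally show False by simp
  qed
  then obtain k i where k: "(\<Sum>i\<in>{..n}. scale (k i) (x ^ i)) \<in> ?I" "i \<le> n" "k i \<noteq> 0" by blast
  define N where "N = (LEAST i. k i \<noteq> 0)"
  have N: "k N \<noteq> 0" "\<And>i. i < N \<Longrightarrow> k i = 0" "N \<le> n"
    unfolding N_def using k LeastI[of "\<lambda>i. k i \<noteq> 0"] not_less_Least Least_le[of "\<lambda>i. k i \<noteq> 0"] by fastforce+
  have "(\<Sum>i\<in>{..n}. scale (k i) (x ^ i)) = (\<Sum>i\<in>{N..n}. scale (k i) (x ^ i))"
    by (rule sum.mono_neutral_right) (use N in auto)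
  also have "\<dots> = scale (k N) (x ^ N) + (\<Sum>i\<in>{Suc N..n}. scale (k i) (x ^ i))"
    using N(3) by (rule sum.atLeast_Suc_atMost)
  also have "(\<Sum>i\<in>{Suc N..n}. scale (k i) (x ^ i)) = x ^ N * (x * (\<Sum>i\<in>{Suc N..n}. scale (k i) (x ^ (i - Suc N))))"
    unfolding sum_distrib_left
  proof (rule sum.cong)
    fix i assume "i \<in> {Suc N..n}"
    then have "x ^ i = x ^ (i - Suc N) * x ^ Suc N"
      by (simp flip: power_add del: power_Suc)
    then show "scale (k i) (x ^ i) = x ^ N * (x * scale (k i) (x ^ (i - Suc N)))"
      by (simp add: mult_scale mult_ac)
  qed simp
  also have "scale (k N) (x ^ N) = x ^ N * scale (k N) 1"
    using scale_mult[of "k N" 1 "x ^ N"] by (simp add: mult.commute)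
  finally have *: "x ^ N * (scale (k N) 1 + x * (\<Sum>i\<in>{Suc N..n}. scale (k i) (x ^ (i - Suc N)))) \<in> ?I"
    (is "x ^ N * ?u \<in> _")
    using k(1) by (simp only: distrib_left)
  obtain w where w: "1 = ?u * w" using unit[OF N(1)] by (rule dvdE)
  have "x ^ N = w * (x ^ N * ?u)" using arg_cong[OF w, of "\<lambda>z. x ^ N * z"] by (simp only: mult_ac mult_1_left)
  then have "x ^ N \<in> ?I" using ideal_pow_mult[OF *] by metis
  then show ?thesis ..
qed

end

section \<open>The germ ring as a complex algebra\<close>

lemma ideal_pow_1: "ideal_pow b c 1 = {x * b + y * c | x y. True}"
  by simp

lemma const_germ_add: "const_germ (x + y) = const_germ x + const_germ y"
  by transfer (simp add: germ_eq_def holomorphic2_near_0_const)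

lemma const_germ_mult: "const_germ (x * y) = const_germ x * const_germ y"
  by transfer (simp add: germ_eq_def holomorphic2_near_0_const)

lemma const_germ_0 [simp]: "const_germ 0 = 0"
  by transfer (simp add: germ_eq_def holomorphic2_near_0_const)

lemma const_germ_1 [simp]: "const_germ 1 = 1"
  by transfer (simp add: germ_eq_def holomorphic2_near_0_const)

lemma const_germ_minus: "const_germ (- x) = - const_germ x"
  by transfer (simp add: germ_eq_def holomorphic2_near_0_const)

interpretation germ_algebra: field_algebra "\<lambda>c f. const_germ c * f"
  by unfold_locales (simp_all add: const_germ_add const_germ_mult algebra_simps)

definition germ_ring :: "germ2 ring" where "germ_ring = ring_of_type_algebra"

lemma germ_ring_simps [simp]:
  "carrier germ_ring = UNIV" "x \<otimes>\<^bsub>germ_ring\<^esub> y = x * y" "x \<oplus>\<^bsub>germ_ring\<^esub> y = x + y"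
  "\<one>\<^bsub>germ_ring\<^esub> = 1" "\<zero>\<^bsub>germ_ring\<^esub> = 0"
  by (simp_all add: germ_ring_def ring_of_type_algebra_def)

lemma germ_ring_cring: "cring germ_ring"
  unfolding germ_ring_def by (rule cring_from_type_algebra)

lemma ideal_pow_1_ideal: "ideal (ideal_pow h k 1) germ_ring"
proof -
  interpret cring germ_ring by (rule germ_ring_cring)
  have um: "\<ominus>\<^bsub>germ_ring\<^esub> x = - x" for x
    by (rule minus_equality) simp_all
  show ?thesis
  proof (rule idealI)
    show "ring germ_ring" by (rule ring_axioms)
    show "subgroup (ideal_pow h k 1) (add_monoid germ_ring)"
    proof (rule add.subgroupI)
      show "ideal_pow h k 1 \<noteq> {}" using ideal_pow_zero[of h k 1] by blast
      show "a \<in> ideal_pow h k 1 \<Longrightarrow> \<ominus>\<^bsub>germ_ring\<^esub> a \<in> ideal_pow h k 1" for a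
        using ideal_pow_mult[of a h k 1 "-1"] by (simp add: um del: ideal_pow.simps One_nat_def)
    qed (simp_all add: ideal_pow_add del: ideal_pow.simps One_nat_def)
    show "x \<otimes>\<^bsub>germ_ring\<^esub> a \<in> ideal_pow h k 1" "a \<otimes>\<^bsub>germ_ring\<^esub> x \<in> ideal_pow h k 1"
      if "a \<in> ideal_pow h k 1" for a x
      using ideal_pow_mult[OF that, of x] by (simp_all add: mult.commute del: ideal_pow.simps One_nat_def)
  qed
qed

lemma genideal_germ: "genideal germ_ring {h, k} = ideal_pow h k 1"
proof -
  interpret cring germ_ring by (rule germ_ring_cring)
  show ?thesis
  proof
    have "h = 1 * h + 0 * k" "k = 0 * h + 1 * k" by simp_all
    then have "{h, k} \<subseteq> ideal_pow h k 1" unfolding ideal_pow_1 by blast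
    then show "Idl\<^bsub>germ_ring\<^esub> {h, k} \<subseteq> ideal_pow h k 1"
      by (rule genideal_minimal[OF ideal_pow_1_ideal])
    interpret I: ideal "Idl\<^bsub>germ_ring\<^esub> {h, k}" germ_ring by (rule genideal_ideal) simp
    have hk: "h \<in> Idl\<^bsub>germ_ring\<^esub> {h, k}" "k \<in> Idl\<^bsub>germ_ring\<^esub> {h, k}"
      using genideal_self[of "{h, k}"] by auto
    show "ideal_pow h k 1 \<subseteq> Idl\<^bsub>germ_ring\<^esub> {h, k}"
    proof
      fix f assume "f \<in> ideal_pow h k 1"
      then obtain x y where "f = x * h + y * k" by auto
      then show "f \<in> Idl\<^bsub>germ_ring\<^esub> {h, k}"
        using I.a_closed[OF I.I_l_closed[OF hk(1), of x] I.I_l_closed[OF hk(2), of y]] by simp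
    qed
  qed
qed

lemma const_germ_subfield: "subfield (range const_germ) germ_ring"
proof -
  interpret cring germ_ring by (rule germ_ring_cring)
  have um: "\<ominus>\<^bsub>germ_ring\<^esub> x = - x" for x
    by (rule minus_equality) simp_all
  show ?thesis
  proof (rule subfieldI)
    show "subcring (range const_germ) germ_ring"
    proof (rule subcringI)
      show "subring (range const_germ) germ_ring"
        by (rule subringI) (auto simp: um simp flip: const_germ_1 const_germ_minus const_germ_add const_germ_mult)
    qed (auto simp: mult.commute)
    show "Units (germ_ring\<lparr>carrier := range const_germ\<rparr>) = range const_germ - {\<zero>\<^bsub>germ_ring\<^esub>}"
    proof -
      have "const_germ x \<noteq> 0 \<Longrightarrow> \<exists>y. const_germ y * const_germ x = 1" for x
        by (rule exI[of _ "inverse x"]) (cases "x = 0"; simp flip: const_germ_mult const_germ_1)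
      then show ?thesis
        by (auto simp: Units_def mult.commute)
    qed
  qed
qed

text \<open>
  The passage from the vector space dimension of the factor ring to families of germs: representatives
  of a basis of the factor ring. Properness is what makes the classes of the constants a field and
  hence the dimension well defined.
\<close>

theorem intersection_multiplicity_basis:
  assumes n: "intersection_multiplicity h k = enat n" and proper: "1 \<notin> ideal_pow h k 1"
  shows "\<exists>e. germ_algebra.basis_mod n e (ideal_pow h k 1)"
proof -
  define I where "I = ideal_pow h k 1"
  define Q where "Q = germ_ring Quot I"
  interpret R: cring germ_ring by (rule germ_ring_cring)
  interpret I: ideal I germ_ring unfolding I_def by (rule ideal_pow_1_ideal)
  interpret Q: ring Q unfolding Q_def by (rule I.quotient_is_ring)
  define cls where "cls = (+>\<^bsub>germ_ring\<^esub>) I"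
  interpret cls: ring_hom_ring germ_ring Q cls
    unfolding cls_def Q_def by (rule I.rcos_ring_hom_ring)
  have cls_0: "cls f = \<zero>\<^bsub>Q\<^esub> \<longleftrightarrow> f \<in> I" for f
    unfolding cls_def Q_def using I.rcos_const_imp_mem I.a_rcos_const by (auto simp: FactRing_def)
  have cls_eq: "f - g \<in> I" if "cls f = cls g" for f g
  proof -
    have "cls (f - g) \<oplus>\<^bsub>Q\<^esub> cls g = \<zero>\<^bsub>Q\<^esub> \<oplus>\<^bsub>Q\<^esub> cls g"
      using cls.hom_add[of "f - g" g] that by simp
    moreover have "cls (f - g) \<in> carrier Q" "cls g \<in> carrier Q" using cls.hom_closed by simp_all
    ultimately have "cls (f - g) = \<zero>\<^bsub>Q\<^esub>" using Q.add.right_cancel[OF _ _ Q.zero_closed] by blast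
    then show ?thesis by (simp only: cls_0)
  qed
  have surj: "carrier Q = range cls"
    unfolding cls_def Q_def by (auto simp: FactRing_def A_RCOSETS_def RCOSETS_def a_r_coset_def)
  define K where "K = range (\<lambda>c. cls (const_germ c))"
  have K: "subfield K Q"
  proof -
    have "\<one>\<^bsub>Q\<^esub> \<noteq> \<zero>\<^bsub>Q\<^esub>" using cls_0[of 1] proper cls.hom_one by (simp add: I_def del: ideal_pow.simps One_nat_def)
    from cls.img_is_subfield(2)[OF const_germ_subfield this] show ?thesis
      by (simp add: K_def image_image)
  qed
  have "intersection_multiplicity h k =
    (if Q.finite_dimension K (carrier Q) then enat (Q.dim K (carrier Q)) else \<infinity>)"
    unfolding intersection_multiplicity_def Let_def germ_ring_def[symmetric] genideal_germ
    by (simp add: I_def[symmetric] Q_def[symmetric] K_def cls_def del: ideal_pow.simps One_nat_def)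
  then have fin: "Q.finite_dimension K (carrier Q)" and "Q.dim K (carrier Q) = n"
    using n by (auto split: if_splits)
  then have "Q.dimension n K (carrier Q)"
    using Q.finite_dimensionE[OF K fin] by (simp add: over_def)
  from Q.exists_base[OF K this] obtain Vs where Vs: "set Vs \<subseteq> carrier Q" "Q.independent K Vs"
    "length Vs = n" "Q.Span K Vs = carrier Q" by blast
  have "\<exists>es. Vs = map cls es" using Vs(1) unfolding surj by (metis ex_map_conv subsetD rangeE)
  then obtain es where es: "Vs = map cls es" ..
  have combine: "Q.combine (map (\<lambda>c. cls (const_germ c)) ks) (map cls es) =
      cls (\<Sum>i<length es. const_germ (ks ! i) * es ! i)" if "length ks = length es" for ks es
    using that
  proof (induction ks es rule: list_induct2)
    case Nil
    then show ?case using cls.hom_zero by simp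
  next
    case (Cons k ks e es)
    have "cls (\<Sum>i<length (e # es). const_germ ((k # ks) ! i) * (e # es) ! i) =
        cls (const_germ k * e + (\<Sum>i<length es. const_germ (ks ! i) * es ! i))"
      unfolding length_Cons sum.lessThan_Suc_shift by simp
    also have "\<dots> = cls (const_germ k) \<otimes>\<^bsub>Q\<^esub> cls e \<oplus>\<^bsub>Q\<^esub> cls (\<Sum>i<length es. const_germ (ks ! i) * es ! i)"
      using cls.hom_add cls.hom_mult by simp
    finally show ?case using Cons.IH by simp
  qed
  have len: "length es = n" using Vs(3) es by simp
  have comb: "Q.combine (map (\<lambda>c. cls (const_germ c)) (map k [0..<n])) Vs =
      cls (\<Sum>i<n. const_germ (k i) * es ! i)" for k
    using combine[of "map k [0..<n]" es] len es by simp
  have "germ_algebra.basis_mod n ((!) es) I"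
    unfolding germ_algebra.basis_mod_def
  proof (intro conjI allI impI)
    fix f
    have "cls f \<in> Q.Span K Vs" unfolding Vs(4) surj by simp
    then obtain Ks where Ks: "cls f = Q.combine Ks Vs" "length Ks = length Vs" "set Ks \<subseteq> K"
      unfolding Q.Span_eq_combine_set_length_version[OF K Vs(1)] by blast
    have "\<exists>ks. Ks = map (\<lambda>c. cls (const_germ c)) ks"
      using Ks(3) unfolding K_def by (metis ex_map_conv subsetD rangeE)
    then obtain ks where ks: "Ks = map (\<lambda>c. cls (const_germ c)) ks" ..
    have "length ks = n" using Ks(2) ks Vs(3) by simp
    then have "cls f = cls (\<Sum>i<n. const_germ (ks ! i) * es ! i)"
      using Ks(1) combine[of ks es] len es ks by simp
    from cls_eq[OF this] show "\<exists>k. f - (\<Sum>i<n. const_germ (k i) * es ! i) \<in> I" by blast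
  next
    fix k i assume "(\<Sum>i<n. const_germ (k i) * es ! i) \<in> I" and i: "i < n"
    then have "Q.combine (map (\<lambda>c. cls (const_germ c)) (map k [0..<n])) Vs = \<zero>\<^bsub>Q\<^esub>"
      unfolding comb cls_0 by simp
    from Q.independent_imp_trivial_combine[OF K Vs(2) _ this]
    have "set (take n (map (\<lambda>c. cls (const_germ c)) (map k [0..<n]))) \<subseteq> {\<zero>\<^bsub>Q\<^esub>}"
      using Vs(3) by (auto simp: K_def)
    then have "cls (const_germ (k i)) = \<zero>\<^bsub>Q\<^esub>" using i by (simp add: image_subset_iff)
    then have "const_germ (k i) \<in> I" by (simp only: cls_0)
    show "k i = 0"
    proof (rule ccontr)
      assume "k i \<noteq> 0"
      then have "1 = const_germ (inverse (k i)) * const_germ (k i)"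
        by (simp flip: const_germ_mult)
      then show False
        using proper ideal_pow_mult \<open>const_germ (k i) \<in> I\<close> unfolding I_def by metis
    qed
  qed
  then show ?thesis unfolding I_def by blast
qed

section \<open>Holomorphic functions of two variables\<close>

lemma ball_subset_ball_0: "ball z (r - norm z) \<subseteq> ball (0::complex) r"
proof
  fix y assume "y \<in> ball z (r - norm z)"
  then show "y \<in> ball 0 r" using norm_triangle_sub[of y z] by (simp add: dist_norm norm_minus_commute)
qed

text \<open>
  Cauchy estimate on the disc of radius \<open>\<rho> / 2\<close>, where \<open>f\<close> is holomorphic up to the boundary;
  \<open>M + 1\<close> turns the bound into a strict one.
\<close>

lemma higher_deriv_bound_on_disc:
  assumes "f holomorphic_on ball 0 r" "\<And>z. z \<in> ball 0 r \<Longrightarrow> cmod (f z) \<le> M" "ball z \<rho> \<subseteq> ball 0 r" "\<rho> > 0"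
    and "n > 0"
  shows "cmod ((deriv ^^ n) f z) \<le> fact n * (M + 1) / (\<rho> / 2) ^ n"
proof (rule Cauchy_higher_deriv_bound[where y = 0])
  have sub: "cball z (\<rho> / 2) \<subseteq> ball z \<rho>" using assms(4) by auto
  with assms(1,3) have "f holomorphic_on cball z (\<rho> / 2)" by (meson holomorphic_on_subset order_trans)
  then show "continuous_on (cball z (\<rho> / 2)) f" "f holomorphic_on ball z (\<rho> / 2)"
    by (auto intro: holomorphic_on_imp_continuous_on holomorphic_on_subset)
  show "f w \<in> ball 0 (M + 1)" if "w \<in> ball z (\<rho> / 2)" for w
  proof -
    have "w \<in> ball 0 r" using that assms(3,4) by (auto simp: subset_iff)
    then show ?thesis using assms(2)[of w] by simp
  qed
qed (use assms in auto)

text \<open>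
  The point of this estimate is that the constant depends only on \<open>M\<close> and \<open>\<rho>\<close>. Applied to the slices
  of a bounded function of two variables it holds uniformly in the other variable. The factor
  \<open>32 = 2 * 4\<^sup>2\<close> is the Cauchy bound for the second derivative on discs of radius \<open>\<rho> / 4\<close>.
\<close>

lemma second_order_taylor_bound:
  assumes f: "f holomorphic_on ball 0 r" "\<And>z. z \<in> ball 0 r \<Longrightarrow> cmod (f z) \<le> M"
    and \<rho>: "ball z0 \<rho> \<subseteq> ball 0 r" "\<rho> > 0" and z: "z \<in> ball z0 (\<rho> / 2)"
  shows "cmod (f z - f z0 - deriv f z0 * (z - z0)) \<le> 32 * (M + 1) / \<rho>\<^sup>2 * (cmod (z - z0))\<^sup>2"
proof -
  have "cmod ((deriv ^^ 0) f z - (\<Sum>i\<le>1. (deriv ^^ i) f z0 * (z - z0) ^ i / fact i)) \<le>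
      (32 * (M + 1) / \<rho>\<^sup>2) * cmod (z - z0) ^ Suc 1 / fact 1"
  proof (rule complex_Taylor[where S = "ball z0 (\<rho> / 2)"])
    show "((deriv ^^ i) f has_field_derivative (deriv ^^ Suc i) f x) (at x within ball z0 (\<rho> / 2))"
      if "x \<in> ball z0 (\<rho> / 2)" for i x
    proof -
      have "x \<in> ball 0 r" using that \<rho> by (auto simp: subset_iff)
      then have "((deriv ^^ i) f has_field_derivative deriv ((deriv ^^ i) f) x) (at x)"
        by (intro holomorphic_derivI[OF holomorphic_higher_deriv[OF f(1)]]) auto
      then show ?thesis by (simp add: has_field_derivative_at_within)
    qed
    show "cmod ((deriv ^^ Suc 1) f x) \<le> 32 * (M + 1) / \<rho>\<^sup>2" if "x \<in> ball z0 (\<rho> / 2)" for x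
    proof -
      have "ball x (\<rho> / 2) \<subseteq> ball z0 \<rho>"
      proof
        fix y assume "y \<in> ball x (\<rho> / 2)"
        then show "y \<in> ball z0 \<rho>" using that dist_triangle[of z0 y x] by simp
      qed
      with \<rho> have sub: "ball x (\<rho> / 2) \<subseteq> ball 0 r" by blast
      have "cmod ((deriv ^^ 2) f x) \<le> fact 2 * (M + 1) / (\<rho> / 2 / 2) ^ 2"
        by (rule higher_deriv_bound_on_disc[OF f sub]) (use \<rho> in auto)
      also have "\<dots> = 32 * (M + 1) / \<rho>\<^sup>2" by (simp add: power2_eq_square)
      finally show ?thesis by (simp add: numeral_2_eq_2)
    qed
  qed (use \<rho> z in auto)
  then show ?thesis by (simp add: power2_eq_square algebra_simps)
qed

text \<open>
  Separately holomorphic with bound \<open>M\<close>. By Osgood's lemma below this is equivalent to bounded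
  holomorphy in both variables jointly, but it can be checked one variable at a time.
\<close>

definition polydisc_holomorphic :: "real \<Rightarrow> real \<Rightarrow> (complex \<times> complex \<Rightarrow> complex) \<Rightarrow> bool"
  where "polydisc_holomorphic r M f \<longleftrightarrow>
    (\<forall>w\<in>ball 0 r. (\<lambda>z. f (z, w)) holomorphic_on ball 0 r) \<and>
    (\<forall>z\<in>ball 0 r. (\<lambda>w. f (z, w)) holomorphic_on ball 0 r) \<and>
    (\<forall>z\<in>ball 0 r. \<forall>w\<in>ball 0 r. cmod (f (z, w)) \<le> M)"

text \<open>
  The difference quotients \<open>q n\<close> in the first variable are holomorphic in the second one, and by the
  Taylor bound they converge uniformly.
\<close>

lemma deriv_fst_holomorphic_snd:
  assumes f: "polydisc_holomorphic r M f" and z0: "z0 \<in> ball 0 r"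
  shows "(\<lambda>w. deriv (\<lambda>z. f (z, w)) z0) holomorphic_on ball 0 r"
proof -
  define \<rho> where "\<rho> = r - norm z0"
  have \<rho>: "\<rho> > 0" using z0 by (simp add: \<rho>_def)
  have sub: "ball z0 \<rho> \<subseteq> ball 0 r"
    unfolding \<rho>_def by (rule ball_subset_ball_0)
  \<comment> \<open>The offset \<open>3\<close> keeps \<open>z0 + h n\<close> in the disc of radius \<open>\<rho> / 2\<close> where the Taylor bound applies.\<close>
  define h where "h n = complex_of_real (\<rho> / (real n + 3))" for n :: nat
  have normh: "cmod (h n) = \<rho> / (real n + 3)" for n
    using \<rho> unfolding h_def norm_of_real by simp
  have hpos: "cmod (h n) > 0" for n using \<rho> by (simp add: normh)
  have hsmall: "z0 + h n \<in> ball z0 (\<rho> / 2)" for n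
    using \<rho> by (simp add: dist_norm normh field_simps add_pos_nonneg)
  have "ball z0 (\<rho> / 2) \<subseteq> ball z0 \<rho>" using \<rho> by auto
  with hsmall sub have hr: "z0 + h n \<in> ball 0 r" for n by blast
  define q where "q n w = (f (z0 + h n, w) - f (z0, w)) / h n" for n w
  define C where "C = 32 * (M + 1) / \<rho>\<^sup>2"
  have M: "M \<ge> 0" 
  proof -
    have "cmod (f (z0, z0)) \<le> M" using f z0 by (auto simp: polydisc_holomorphic_def)
    then show ?thesis by (meson norm_ge_zero order_trans)
  qed
  have C: "C \<ge> 0" using M by (simp add: C_def)
  have est: "cmod (q n w - deriv (\<lambda>z. f (z, w)) z0) \<le> C * \<rho> / (real n + 3)" if w: "w \<in> ball 0 r" for n w
  proof -
    let ?D = "deriv (\<lambda>z. f (z, w)) z0"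
    have "cmod (f (z0 + h n, w) - f (z0, w) - ?D * (z0 + h n - z0)) \<le> C * (cmod (z0 + h n - z0))\<^sup>2"
      unfolding C_def
      by (rule second_order_taylor_bound[of "\<lambda>z. f (z, w)" r M z0 \<rho>, OF _ _ sub \<rho> hsmall])
         (use f w in \<open>auto simp: polydisc_holomorphic_def\<close>)
    then have "cmod (f (z0 + h n, w) - f (z0, w) - ?D * h n) \<le> C * (cmod (h n))\<^sup>2" by simp
    also have "f (z0 + h n, w) - f (z0, w) - ?D * h n = (q n w - ?D) * h n"
      using hpos[of n] by (auto simp: q_def algebra_simps)
    finally have "cmod (q n w - ?D) * cmod (h n) \<le> (C * cmod (h n)) * cmod (h n)"
      by (simp add: norm_mult power2_eq_square mult.assoc)
    then have "cmod (q n w - ?D) \<le> C * cmod (h n)" using hpos[of n] by simp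
    then show ?thesis by (simp add: normh)
  qed
  have lim: "(\<lambda>n. C * \<rho> / (real n + 3)) \<longlonglongrightarrow> 0" by real_asymp
  show ?thesis
  proof (rule holomorphic_uniform_sequence[where f = q])
    show "q n holomorphic_on ball 0 r" for n
      unfolding q_def using f z0 hr hpos[of n]
      by (intro holomorphic_intros) (auto simp: polydisc_holomorphic_def)
    fix x :: complex assume "x \<in> ball 0 r"
    then obtain d where d: "d > 0" "cball x d \<subseteq> ball 0 r" by (meson open_ball open_contains_cball)
    have "uniform_limit (cball x d) q (\<lambda>w. deriv (\<lambda>z. f (z, w)) z0) sequentially"
    proof (rule uniform_limitI)
      fix e :: real assume "e > 0"
      then have "\<forall>\<^sub>F n in sequentially. C * \<rho> / (real n + 3) < e" using order_tendstoD(2)[OF lim] by blast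
      then show "\<forall>\<^sub>F n in sequentially. \<forall>x\<in>cball x d. dist (q n x) (deriv (\<lambda>z. f (z, x)) z0) < e"
      proof eventually_elim
        case (elim n)
        show ?case
        proof
          fix w assume "w \<in> cball x d"
          then have "w \<in> ball 0 r" using d by blast
          from est[OF this, of n] elim show "dist (q n w) (deriv (\<lambda>z. f (z, w)) z0) < e"
            by (simp add: dist_norm)
        qed
      qed
    qed
    then show "\<exists>d>0. cball x d \<subseteq> ball 0 r \<and>
        uniform_limit (cball x d) q (\<lambda>w. deriv (\<lambda>z. f (z, w)) z0) sequentially"
      using d by blast
  qed simp
qed

lemma polydisc_holomorphic_mono:
  assumes "polydisc_holomorphic r M f" "s \<le> r"
  shows "polydisc_holomorphic s M f"
proof -
  have "ball (0::complex) s \<subseteq> ball 0 r" using assms(2) by auto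
  then show ?thesis
    using assms(1) unfolding polydisc_holomorphic_def by (meson holomorphic_on_subset subsetD)
qed

lemma polydisc_holomorphic_swap:
  "polydisc_holomorphic r M f \<Longrightarrow> polydisc_holomorphic r M (\<lambda>(z, w). f (w, z))"
  by (auto simp: polydisc_holomorphic_def)

text \<open>
  Osgood's lemma. The increment of \<open>f\<close> at \<open>(z0, w0)\<close> splits into a second-order error in the second
  variable (uniformly small by the Taylor bound), an increment in the first variable alone, and the
  variation of the partial derivative \<open>g\<close> with respect to the second variable, which is continuous in
  \<open>z\<close> because it is holomorphic.
\<close>

lemma osgood_lemma:
  assumes f: "polydisc_holomorphic r M f"
  shows "holomorphic2_on f (ball 0 r \<times> ball 0 r)"
  unfolding holomorphic2_on_def
proof
  fix p assume "p \<in> ball (0::complex) r \<times> ball (0::complex) r"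
  then obtain z0 w0 where p: "p = (z0, w0)" and z0: "z0 \<in> ball 0 r" and w0: "w0 \<in> ball 0 r" by auto
  define \<rho> where "\<rho> = r - norm w0"
  have \<rho>: "\<rho> > 0" using w0 by (simp add: \<rho>_def)
  have sub: "ball w0 \<rho> \<subseteq> ball 0 r"
    unfolding \<rho>_def by (rule ball_subset_ball_0)
  define C where "C = 32 * (M + 1) / \<rho>\<^sup>2"
  define g where "g z = deriv (\<lambda>w. f (z, w)) w0" for z
  have "g holomorphic_on ball 0 r"
    using deriv_fst_holomorphic_snd[OF polydisc_holomorphic_swap[OF f] w0] by (simp add: g_def[abs_def])
  then have "continuous_on (ball 0 r) g" by (rule holomorphic_on_imp_continuous_on)
  then have gcont: "isCont g z0" using z0 by (simp add: continuous_on_eq_continuous_at)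
  have "(\<lambda>z. f (z, w0)) holomorphic_on ball 0 r" using f w0 by (auto simp: polydisc_holomorphic_def)
  then have A: "((\<lambda>z. f (z, w0)) has_field_derivative deriv (\<lambda>z. f (z, w0)) z0) (at z0)"
    by (rule holomorphic_derivI) (use z0 in auto)
  define A where "A = deriv (\<lambda>z. f (z, w0)) z0"
  have est: "cmod (f (z, w) - f (z, w0) - g z * (w - w0)) \<le> C * (cmod (w - w0))\<^sup>2"
    if "z \<in> ball 0 r" "w \<in> ball w0 (\<rho> / 2)" for z w
    unfolding C_def g_def
    by (rule second_order_taylor_bound[of "\<lambda>w. f (z, w)" r M w0 \<rho>, OF _ _ sub \<rho> that(2)])
       (use f that in \<open>auto simp: polydisc_holomorphic_def\<close>)
  have "(f has_derivative (\<lambda>(h, k). A * h + g z0 * k)) (at (z0, w0))"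
    unfolding has_derivative_at_alt
  proof (intro conjI allI impI)
    show "bounded_linear (\<lambda>(h, k). A * h + g z0 * k)"
      unfolding case_prod_unfold by (intro bounded_linear_intros)
    fix e :: real assume e: "e > 0"
    obtain d1 where d1: "d1 > 0" "\<And>z. norm (z - z0) < d1 \<Longrightarrow>
        norm (f (z, w0) - f (z0, w0) - A * (z - z0)) \<le> e / 3 * norm (z - z0)"
      using A e unfolding has_field_derivative_def has_derivative_at_alt A_def
      by (metis divide_pos_pos zero_less_numeral)
    obtain d2 where d2: "d2 > 0" "\<And>z. norm (z - z0) < d2 \<Longrightarrow> norm (g z - g z0) < e / 3"
      using gcont e unfolding continuous_at_eps_delta dist_norm by (metis divide_pos_pos zero_less_numeral)
    define d3 where "d3 = e / (3 * (\<bar>C\<bar> + 1))"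
    have d3: "d3 > 0" using e by (simp add: d3_def)
    have Cd3: "C * t \<le> e / 3" if "t \<ge> 0" "t < d3" for t
    proof -
      have "C * t \<le> (\<bar>C\<bar> + 1) * t" using that by (intro mult_right_mono) auto
      also have "\<dots> \<le> (\<bar>C\<bar> + 1) * d3" using that by (intro mult_left_mono) auto
      also have "\<dots> = e / 3" by (simp add: d3_def field_simps)
      finally show ?thesis .
    qed
    define d where "d = min (min d1 d2) (min d3 (min (\<rho> / 2) (r - norm z0)))"
    have "d > 0" using d1 d2 d3 \<rho> z0 by (simp add: d_def)
    moreover have "norm (f p - f (z0, w0) - (case p - (z0, w0) of (h, k) \<Rightarrow> A * h + g z0 * k)) \<le> e * norm (p - (z0, w0))"
      if pd: "norm (p - (z0, w0)) < d" for p
    proof -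
      obtain z w where p: "p = (z, w)" by force
      let ?n = "norm (p - (z0, w0))"
      have nz: "norm (z - z0) \<le> ?n" and nw: "norm (w - w0) \<le> ?n"
        using norm_fst_le[of "z - z0" "w - w0"] norm_snd_le[of "w - w0" "z - z0"] by (simp_all add: p)
      have zr: "z \<in> ball 0 r"
        using pd nz norm_triangle_sub[of z z0] by (simp add: d_def)
      have wr: "w \<in> ball w0 (\<rho> / 2)" using pd nw by (simp add: d_def dist_norm norm_minus_commute)
      have 1: "cmod (f (z, w) - f (z, w0) - g z * (w - w0)) \<le> e / 3 * ?n"
      proof -
        have "cmod (f (z, w) - f (z, w0) - g z * (w - w0)) \<le> (C * cmod (w - w0)) * cmod (w - w0)"
          using est[OF zr wr] by (simp add: power2_eq_square mult.assoc)
        also have "\<dots> \<le> e / 3 * cmod (w - w0)"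
          using Cd3[of "cmod (w - w0)"] pd nw by (intro mult_right_mono) (auto simp: d_def)
        also have "\<dots> \<le> e / 3 * ?n" using nw e by (intro mult_left_mono) auto
        finally show ?thesis .
      qed
      have 2: "cmod (f (z, w0) - f (z0, w0) - A * (z - z0)) \<le> e / 3 * ?n"
      proof -
        have "cmod (f (z, w0) - f (z0, w0) - A * (z - z0)) \<le> e / 3 * cmod (z - z0)"
          using d1(2)[of z] pd nz by (simp add: d_def)
        also have "\<dots> \<le> e / 3 * ?n" using nz e by (intro mult_left_mono) auto
        finally show ?thesis .
      qed
      have 3: "cmod ((g z - g z0) * (w - w0)) \<le> e / 3 * ?n"
        unfolding norm_mult using d2(2)[of z] pd nz nw e by (intro mult_mono) (auto simp: d_def)
      have "f p - f (z0, w0) - (case p - (z0, w0) of (h, k) \<Rightarrow> A * h + g z0 * k) =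
          (f (z, w) - f (z, w0) - g z * (w - w0)) + (f (z, w0) - f (z0, w0) - A * (z - z0)) +
          (g z - g z0) * (w - w0)"
        by (simp add: p algebra_simps)
      also have "cmod \<dots> \<le> e / 3 * ?n + e / 3 * ?n + e / 3 * ?n"
        by (intro order_trans[OF norm_triangle_ineq] add_mono 1 2 3)
      finally show ?thesis by simp
    qed
    ultimately show "\<exists>d>0. \<forall>y. norm (y - (z0, w0)) < d \<longrightarrow>
        norm (f y - f (z0, w0) - (case y - (z0, w0) of (h, k) \<Rightarrow> A * h + g z0 * k)) \<le> e * norm (y - (z0, w0))"
      by blast
  qed
  then show "\<exists>A B. (f has_derivative (\<lambda>(h, k). A * h + B * k)) (at p)" unfolding p by blast
qed

lemma polydisc_holomorphic_imp_near_0: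
  assumes "polydisc_holomorphic r M f" "r > 0"
  shows "holomorphic2_near_0 f"
  unfolding holomorphic2_near_0_def
  using osgood_lemma[OF assms(1)] assms(2) open_Times[of "ball (0::complex) r" "ball (0::complex) r"]
  by (metis centre_in_ball mem_Sigma_iff open_ball)

lemma holomorphic2_near_0_polydisc:
  assumes "holomorphic2_near_0 f"
  obtains r M where "r > 0" "polydisc_holomorphic r M f"
proof -
  from assms obtain S where S: "open S" "(0, 0) \<in> S" "holomorphic2_on f S"
    unfolding holomorphic2_near_0_def by blast
  have "isCont f (0, 0)" using S(2,3) has_derivative_continuous unfolding holomorphic2_on_def by blast
  then have "\<forall>\<^sub>F p in nhds (0, 0). dist (f p) (f (0, 0)) < 1"
    unfolding isCont_def tendsto_at_iff_tendsto_nhds by (rule tendstoD) simp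
  moreover have "\<forall>\<^sub>F p in nhds (0, 0). p \<in> S" using S eventually_nhds by blast
  ultimately have "\<forall>\<^sub>F p in nhds (0, 0). dist (f p) (f (0, 0)) < 1 \<and> p \<in> S" by (rule eventually_conj)
  then obtain r where r: "r > 0" "\<And>z w. norm z < r \<Longrightarrow> norm w < r \<Longrightarrow> dist (f (z, w)) (f (0, 0)) < 1 \<and> (z, w) \<in> S"
    using nhds_00_box by blast
  have bd: "cmod (f (z, w)) \<le> cmod (f (0, 0)) + 1" if "norm z < r" "norm w < r" for z w
    using r(2)[OF that] norm_triangle_sub[of "f (z, w)" "f (0, 0)"] by (simp add: dist_norm)
  have "polydisc_holomorphic r (cmod (f (0, 0)) + 1) f"
    unfolding polydisc_holomorphic_def
    using slices_holomorphic[OF S(3,1), of r] r(2) bd by auto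
  with r(1) show ?thesis by (rule that)
qed

lemma polydisc_holomorphic_deriv_fst:
  assumes f: "polydisc_holomorphic r M f"
  shows "polydisc_holomorphic (r / 2) (4 * (M + 1) / r) (\<lambda>(z, w). deriv (\<lambda>z. f (z, w)) z)"
proof (cases "r > 0")
  case r: True
  have in_r: "z \<in> ball 0 r" if "z \<in> ball 0 (r / 2)" for z :: complex using that r by auto
  show ?thesis
    unfolding polydisc_holomorphic_def prod.case
  proof (intro conjI ballI)
    fix w :: complex assume w: "w \<in> ball 0 (r / 2)"
    have hol: "(\<lambda>z. f (z, w)) holomorphic_on ball 0 r" using f in_r[OF w] by (auto simp: polydisc_holomorphic_def)
    show "deriv (\<lambda>z. f (z, w)) holomorphic_on ball 0 (r / 2)"
      by (rule holomorphic_on_subset[OF holomorphic_deriv[OF hol]]) (use r in auto)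
    show "(\<lambda>w'. deriv (\<lambda>z. f (z, w')) w) holomorphic_on ball 0 (r / 2)"
      by (rule holomorphic_on_subset[OF deriv_fst_holomorphic_snd[OF f in_r[OF w]]]) (use r in auto)
  next
    fix z w :: complex assume z: "z \<in> ball 0 (r / 2)" and w: "w \<in> ball 0 (r / 2)"
    have "cmod ((deriv ^^ 1) (\<lambda>z. f (z, w)) z) \<le> fact 1 * (M + 1) / (r / 2 / 2) ^ 1"
    proof (rule higher_deriv_bound_on_disc)
      show "ball z (r / 2) \<subseteq> ball 0 r"
      proof
        fix y assume "y \<in> ball z (r / 2)"
        then show "y \<in> ball 0 r" using z norm_triangle_sub[of y z] by (simp add: dist_norm norm_minus_commute)
      qed
    qed (use f in_r[OF w] r in \<open>auto simp: polydisc_holomorphic_def\<close>)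
    then show "cmod (deriv (\<lambda>z. f (z, w)) z) \<le> 4 * (M + 1) / r" by (simp add: field_simps)
  qed
next
  case False
  then have "ball (0::complex) (r / 2) = {}" by simp
  then show ?thesis by (simp only: polydisc_holomorphic_def ball_empty) simp
qed

lemma holomorphic2_deriv_fst:
  assumes "holomorphic2_near_0 f"
  shows "\<exists>g. holomorphic2_near_0 g \<and>
    (\<forall>\<^sub>F p in nhds (0, 0). ((\<lambda>z. f (z, snd p)) has_field_derivative g p) (at (fst p)))"
proof -
  obtain r M where r: "r > 0" and f: "polydisc_holomorphic r M f"
    using holomorphic2_near_0_polydisc[OF assms] by blast
  define g where "g = (\<lambda>(z, w). deriv (\<lambda>z. f (z, w)) z)"
  have "holomorphic2_near_0 g"
    unfolding g_def by (rule polydisc_holomorphic_imp_near_0[OF polydisc_holomorphic_deriv_fst[OF f]]) (use r in simp)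
  moreover have "((\<lambda>z. f (z, w)) has_field_derivative g (z, w)) (at z)" if "norm z < r" "norm w < r" for z w
  proof -
    have "(\<lambda>z. f (z, w)) holomorphic_on ball 0 r" using f that by (auto simp: polydisc_holomorphic_def)
    then show ?thesis unfolding g_def prod.case by (rule holomorphic_derivI) (use that in auto)
  qed
  then have "\<forall>\<^sub>F p in nhds (0, 0). ((\<lambda>z. f (z, snd p)) has_field_derivative g p) (at (fst p))"
    by (intro box_nhds_00[OF r]) simp
  ultimately show ?thesis by blast
qed

lemma holomorphic2_near_0_swap:
  assumes "holomorphic2_near_0 f" shows "holomorphic2_near_0 (\<lambda>p. f (snd p, fst p))"
proof -
  obtain r M where r: "r > 0" and f: "polydisc_holomorphic r M f"
    using holomorphic2_near_0_polydisc[OF assms] by blast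
  from polydisc_holomorphic_imp_near_0[OF polydisc_holomorphic_swap[OF f] r]
  show ?thesis by (simp add: case_prod_unfold)
qed

lemma eventually_nhds_swap:
  assumes "\<forall>\<^sub>F p in nhds (0::'a::real_normed_vector, 0::'b::real_normed_vector). P p"
  shows "\<forall>\<^sub>F p in nhds (0, 0). P (snd p, fst p)"
proof -
  obtain r where "r > 0" "\<And>z w. norm z < r \<Longrightarrow> norm w < r \<Longrightarrow> P (z, w)" using nhds_00_box[OF assms] by blast
  then show ?thesis by (intro box_nhds_00) auto
qed

lemma holomorphic2_deriv_snd:
  assumes "holomorphic2_near_0 f"
  shows "\<exists>g. holomorphic2_near_0 g \<and>
    (\<forall>\<^sub>F p in nhds (0, 0). ((\<lambda>w. f (fst p, w)) has_field_derivative g p) (at (snd p)))"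
proof -
  obtain g where g: "holomorphic2_near_0 g" "\<forall>\<^sub>F p in nhds (0, 0).
      ((\<lambda>z. f (snd p, z)) has_field_derivative g p) (at (fst p))"
    using holomorphic2_deriv_fst[OF holomorphic2_near_0_swap[OF assms]] by auto
  show ?thesis
    using holomorphic2_near_0_swap[OF g(1)] eventually_nhds_swap[OF g(2)] by auto
qed

text \<open>
  Division by the first coordinate. The quotient, completed by the partial derivative on the line
  \<open>z = 0\<close>, is separately holomorphic (in \<open>z\<close> by removal of the singularity) and bounded (by the
  mean value inequality), so Osgood's lemma applies.
\<close>

lemma holomorphic2_divide_fst:
  assumes "holomorphic2_near_0 f" and "\<forall>\<^sub>F p in nhds (0, 0). fst p = 0 \<longrightarrow> f p = 0"
  shows "\<exists>g. holomorphic2_near_0 g \<and> (\<forall>\<^sub>F p in nhds (0, 0). f p = fst p * g p)"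
proof -
  obtain r1 M where r1: "r1 > 0" and f1: "polydisc_holomorphic r1 M f"
    using holomorphic2_near_0_polydisc[OF assms(1)] by blast
  obtain r2 where r2: "r2 > 0" "\<And>w. norm w < r2 \<Longrightarrow> f (0, w) = 0"
    using nhds_00_box[OF assms(2)] by (metis fst_conv norm_zero)
  define r where "r = min r1 r2"
  have r: "r > 0" using r1 r2 by (simp add: r_def)
  have f: "polydisc_holomorphic r M f"
    by (rule polydisc_holomorphic_mono[OF f1]) (simp add: r_def)
  have f_half: "polydisc_holomorphic (r / 2) M f"
    by (rule polydisc_holomorphic_mono[OF f]) (use r in simp)
  have f0: "f (0, w) = 0" if "w \<in> ball 0 r" for w using r2(2)[of w] that by (simp add: r_def)
  define B where "B = 4 * (M + 1) / r"
  have d: "cmod (deriv (\<lambda>z. f (z, w)) z) \<le> B" if "z \<in> ball 0 (r / 2)" "w \<in> ball 0 (r / 2)" for z w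
    using polydisc_holomorphic_deriv_fst[OF f] that by (auto simp: polydisc_holomorphic_def B_def)
  define g where "g = (\<lambda>(z, w). if z = 0 then deriv (\<lambda>z. f (z, w)) 0 else f (z, w) / z)"
  have in_r: "z \<in> ball 0 r" if "z \<in> ball 0 (r / 2)" for z :: complex using that r by auto
  have "polydisc_holomorphic (r / 2) B g"
    unfolding polydisc_holomorphic_def
  proof (intro conjI ballI)
    fix w :: complex assume w: "w \<in> ball 0 (r / 2)"
    have hol: "(\<lambda>z. f (z, w)) holomorphic_on ball 0 (r / 2)"
      using f_half w by (auto simp: polydisc_holomorphic_def)
    have "(\<lambda>z. if z = 0 then deriv (\<lambda>z. f (z, w)) 0 else (f (z, w) - f (0, w)) / (z - 0))
        holomorphic_on ball 0 (r / 2)"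
      by (rule pole_lemma[OF hol]) (use r in simp)
    then show "(\<lambda>z. g (z, w)) holomorphic_on ball 0 (r / 2)"
      using f0[OF in_r[OF w]] by (simp add: g_def cong: if_cong)
    show "(\<lambda>w'. g (w, w')) holomorphic_on ball 0 (r / 2)"
    proof (cases "w = 0")
      case True
      have "(\<lambda>w'. deriv (\<lambda>z. f (z, w')) 0) holomorphic_on ball 0 r"
        by (rule deriv_fst_holomorphic_snd[OF f]) (use r in simp)
      then show ?thesis using True r by (auto simp: g_def intro: holomorphic_on_subset)
    next
      case False
      have "(\<lambda>w'. f (w, w')) holomorphic_on ball 0 (r / 2)"
        using f_half w by (auto simp: polydisc_holomorphic_def)
      then show ?thesis using False by (auto simp: g_def intro!: holomorphic_intros)
    qed
  next
    fix z w :: complex assume z: "z \<in> ball 0 (r / 2)" and w: "w \<in> ball 0 (r / 2)"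
    show "cmod (g (z, w)) \<le> B"
    proof (cases "z = 0")
      case True
      then show ?thesis using d[OF z w] by (simp add: g_def)
    next
      case False
      have "(\<lambda>z. f (z, w)) holomorphic_on ball 0 (r / 2)"
        using f_half w by (auto simp: polydisc_holomorphic_def)
      then have "cmod (f (z, w) - f (0, w)) \<le> B * cmod (z - 0)"
        by (intro field_differentiable_bound[where S = "ball 0 (r / 2)" and f' = "deriv (\<lambda>z. f (z, w))"])
           (use z r d w in \<open>auto intro: holomorphic_derivI\<close>)
      then show ?thesis using False f0[OF in_r[OF w]] by (simp add: g_def norm_divide field_simps)
    qed
  qed
  then have "holomorphic2_near_0 g" by (rule polydisc_holomorphic_imp_near_0) (use r in simp)
  moreover have "\<forall>\<^sub>F p in nhds (0, 0). f p = fst p * g p"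
    by (rule box_nhds_00[OF r]) (use f0 in \<open>auto simp: g_def\<close>)
  ultimately show ?thesis by blast
qed

section \<open>Ideals of finite colength in the germ ring\<close>

lemma is_germ_of_holomorphic: "is_germ_of f F \<Longrightarrow> holomorphic2_near_0 F"
  by transfer (simp add: germ_eq_def)

lemma is_germ_of_exists: "\<exists>F. is_germ_of f F"
  by transfer blast

lemma germ_of_exists: "holomorphic2_near_0 F \<Longrightarrow> \<exists>f. is_germ_of f F"
  by transfer (auto simp: germ_eq_def)

lemma is_germ_of_eq_iff:
  assumes "is_germ_of f F" "is_germ_of g G"
  shows "f = g \<longleftrightarrow> (\<forall>\<^sub>F p in nhds (0, 0). F p = G p)"
proof -
  have "holomorphic2_near_0 F" "holomorphic2_near_0 G" using assms is_germ_of_holomorphic by auto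
  with assms show ?thesis
  proof transfer
    fix f F g G
    assume "germ_eq f F" "germ_eq g G" "holomorphic2_near_0 F" "holomorphic2_near_0 G"
    then show "germ_eq f g \<longleftrightarrow> (\<forall>\<^sub>F p in nhds (0, 0). F p = G p)"
      by (metis germ_eq_def germ_eq_sym germ_eq_trans)
  qed
qed

lemma is_germ_of_add:
  "is_germ_of f F \<Longrightarrow> is_germ_of g G \<Longrightarrow> is_germ_of (f + g) (\<lambda>p. F p + G p)"
  by transfer (auto simp: germ_eq_def holomorphic2_near_0_lin elim: eventually_elim2)

lemma is_germ_of_diff:
  "is_germ_of f F \<Longrightarrow> is_germ_of g G \<Longrightarrow> is_germ_of (f - g) (\<lambda>p. F p - G p)"
  by transfer (auto simp: germ_eq_def holomorphic2_near_0_diff elim: eventually_elim2)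

lemma is_germ_of_mult:
  "is_germ_of f F \<Longrightarrow> is_germ_of g G \<Longrightarrow> is_germ_of (f * g) (\<lambda>p. F p * G p)"
  by transfer (auto simp: germ_eq_def holomorphic2_near_0_lin elim: eventually_elim2)

lemma is_germ_of_const: "is_germ_of (const_germ c) (\<lambda>_. c)"
  by transfer (simp add: germ_eq_def holomorphic2_near_0_const)

lemma is_germ_of_0: "is_germ_of 0 (\<lambda>_. 0)" and is_germ_of_1: "is_germ_of 1 (\<lambda>_. 1)"
  using is_germ_of_const[of 0] is_germ_of_const[of 1] by simp_all

lift_definition germ_value :: "germ2 \<Rightarrow> complex" is "\<lambda>f. f (0, 0)"
  by (auto simp: germ_eq_def dest: eventually_nhds_x_imp_x)

lemma germ_value_eq: "is_germ_of f F \<Longrightarrow> germ_value f = F (0, 0)"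
  by transfer (auto simp: germ_eq_def dest: eventually_nhds_x_imp_x)

lemma germ_value_simps [simp]:
  "germ_value (f + g) = germ_value f + germ_value g"
  "germ_value (f * g) = germ_value f * germ_value g"
  "germ_value (const_germ c) = c" "germ_value 1 = 1" "germ_value 0 = 0"
  by (transfer, simp)+

lemma holomorphic2_near_0_fst: "holomorphic2_near_0 fst"
  unfolding holomorphic2_near_0_def holomorphic2_on_def
proof (intro exI[of _ UNIV] conjI ballI open_UNIV UNIV_I exI)
  fix p :: "complex \<times> complex"
  show "(fst has_derivative (\<lambda>(h, k). 1 * h + 0 * k)) (at p)"
    by (rule has_derivative_eq_rhs[OF bounded_linear_imp_has_derivative[OF bounded_linear_fst]])
       (simp add: fun_eq_iff)
qed

lemma holomorphic2_near_0_snd: "holomorphic2_near_0 snd"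
  using holomorphic2_near_0_swap[OF holomorphic2_near_0_fst] by simp

lift_definition germ_u :: germ2 is fst
  by (simp add: germ_eq_def holomorphic2_near_0_fst)

lift_definition germ_v :: germ2 is snd
  by (simp add: germ_eq_def holomorphic2_near_0_snd)

lemma is_germ_of_u: "is_germ_of germ_u fst"
  by transfer (simp add: germ_eq_def holomorphic2_near_0_fst)

lemma is_germ_of_v: "is_germ_of germ_v snd"
  by transfer (simp add: germ_eq_def holomorphic2_near_0_snd)

lemma germ_unit:
  assumes "germ_value f \<noteq> 0"
  shows "f dvd 1"
proof -
  obtain F where F: "is_germ_of f F" using is_germ_of_exists by blast
  from is_germ_of_holomorphic[OF F] obtain S where S: "open S" "(0, 0) \<in> S" "holomorphic2_on F S"
    unfolding holomorphic2_near_0_def by blast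
  have "continuous_on S F"
    using S(1,3) has_derivative_continuous unfolding holomorphic2_on_def
    by (metis continuous_at_imp_continuous_on)
  then have "open (S \<inter> F -` (- {0}))"
    using S(1) continuous_on_open_vimage[of S F] by (metis Int_commute open_Compl closed_singleton)
  moreover have 0: "(0, 0) \<in> S \<inter> F -` (- {0})" using S(2) assms germ_value_eq[OF F] by simp
  moreover have "holomorphic2_on (\<lambda>p. inverse (F p)) (S \<inter> F -` (- {0}))"
    unfolding holomorphic2_on_def
  proof
    fix p assume p: "p \<in> S \<inter> F -` (- {0})"
    then obtain A B where "(F has_derivative (\<lambda>(h, k). A * h + B * k)) (at p)"
      using S(3) unfolding holomorphic2_on_def by blast
    from Deriv.has_derivative_inverse[OF _ this]
    have "((\<lambda>p. inverse (F p)) has_derivative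
        (\<lambda>h. - (inverse (F p) * (case h of (h, k) \<Rightarrow> A * h + B * k) * inverse (F p)))) (at p)"
      using p by auto
    then have "((\<lambda>p. inverse (F p)) has_derivative
        (\<lambda>(h, k). (- (inverse (F p) * A * inverse (F p))) * h + (- (inverse (F p) * B * inverse (F p))) * k)) (at p)"
      by (rule has_derivative_eq_rhs) (auto simp: fun_eq_iff algebra_simps)
    then show "\<exists>A B. ((\<lambda>p. inverse (F p)) has_derivative (\<lambda>(h, k). A * h + B * k)) (at p)" by blast
  qed
  ultimately have "holomorphic2_near_0 (\<lambda>p. inverse (F p))"
    unfolding holomorphic2_near_0_def by blast
  then obtain g where g: "is_germ_of g (\<lambda>p. inverse (F p))" using germ_of_exists by blast
  have "\<forall>\<^sub>F p in nhds (0, 0). p \<in> S \<inter> F -` (- {0})"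
    using \<open>open (S \<inter> F -` (- {0}))\<close> 0 eventually_nhds by blast
  then have "\<forall>\<^sub>F p in nhds (0, 0). 1 = F p * inverse (F p)"
    by eventually_elim auto
  then have "1 = f * g" using is_germ_of_eq_iff[OF is_germ_of_1 is_germ_of_mult[OF F g]] by blast
  then show ?thesis by (rule dvdI)
qed

lemma isCont_zero_if_punctured_zero:
  fixes f :: "complex \<Rightarrow> complex"
  assumes "isCont f 0" "r > 0" "\<And>z. z \<noteq> 0 \<Longrightarrow> norm z < r \<Longrightarrow> f z = 0"
  shows "f 0 = 0"
proof -
  have "\<forall>\<^sub>F z in at 0. f z = 0"
    unfolding eventually_at using assms(2,3) by auto
  then have "f \<midarrow>0\<rightarrow> 0" by (rule tendsto_eventually)
  with assms(1) show ?thesis unfolding isCont_def using tendsto_unique[OF at_neq_bot] by blast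
qed

text \<open>
  This lemma and the next one say that the coordinates \<open>u, v\<close> form a regular sequence in the germ
  ring.
\<close>

lemma germ_u_cancel:
  assumes "germ_u * f = 0"
  shows "f = 0"
proof -
  obtain F where F: "is_germ_of f F" using is_germ_of_exists by blast
  obtain r M where r: "r > 0" and P: "polydisc_holomorphic r M F"
    using holomorphic2_near_0_polydisc[OF is_germ_of_holomorphic[OF F]] by blast
  have "\<forall>\<^sub>F p in nhds (0, 0). fst p * F p = 0"
    using is_germ_of_eq_iff[OF is_germ_of_mult[OF is_germ_of_u F] is_germ_of_0] assms by simp
  then obtain s where s: "s > 0" "\<And>z w. norm z < s \<Longrightarrow> norm w < s \<Longrightarrow> z * F (z, w) = 0"
    by (rule nhds_00_box) auto
  have "F (z, w) = 0" if zw: "norm z < min r s" "norm w < min r s" for z w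
  proof (cases "z = 0")
    case True
    have "(\<lambda>z. F (z, w)) holomorphic_on ball 0 r" using P zw by (auto simp: polydisc_holomorphic_def)
    then have "isCont (\<lambda>z. F (z, w)) 0"
      using r by (meson holomorphic_on_imp_continuous_on continuous_on_eq_continuous_at open_ball centre_in_ball)
    then have "F (0, w) = 0"
      by (rule isCont_zero_if_punctured_zero[OF _ s(1)]) (use s(2) zw in force)
    then show ?thesis using True by simp
  qed (use s(2)[of z w] zw in auto)
  then have "\<forall>\<^sub>F p in nhds (0, 0). F p = 0"
    using r s(1) by (intro box_nhds_00[of "min r s"]) auto
  then show ?thesis using is_germ_of_eq_iff[OF F is_germ_of_0] by simp
qed

text \<open>
  If \<open>u\<close> divides \<open>v f\<close>, then \<open>f\<close> vanishes on the line \<open>u = 0\<close> away from the origin, hence by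
  continuity on the whole line, and \<open>f\<close> can be divided by \<open>u\<close>.
\<close>

lemma germ_u_dvd_v_mult:
  assumes "germ_u dvd germ_v * f"
  shows "germ_u dvd f"
proof -
  obtain F where F: "is_germ_of f F" using is_germ_of_exists by blast
  obtain r M where r: "r > 0" and P: "polydisc_holomorphic r M F"
    using holomorphic2_near_0_polydisc[OF is_germ_of_holomorphic[OF F]] by blast
  obtain t where t: "germ_v * f = germ_u * t" using assms by (rule dvdE)
  obtain T where T: "is_germ_of t T" using is_germ_of_exists by blast
  have "\<forall>\<^sub>F p in nhds (0, 0). snd p * F p = fst p * T p"
    using is_germ_of_eq_iff[OF is_germ_of_mult[OF is_germ_of_v F] is_germ_of_mult[OF is_germ_of_u T]] t by simp
  then obtain s where s: "s > 0" "\<And>z w. norm z < s \<Longrightarrow> norm w < s \<Longrightarrow> w * F (z, w) = z * T (z, w)"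
    by (rule nhds_00_box) auto
  have punct: "F (0, w) = 0" if "w \<noteq> 0" "norm w < s" for w using s(2)[of 0 w] s(1) that by simp
  have "(\<lambda>w. F (0, w)) holomorphic_on ball 0 r" using P r by (auto simp: polydisc_holomorphic_def)
  then have "isCont (\<lambda>w. F (0, w)) 0"
    using r by (meson holomorphic_on_imp_continuous_on continuous_on_eq_continuous_at open_ball centre_in_ball)
  then have "F (0, 0) = 0"
    by (rule isCont_zero_if_punctured_zero[OF _ s(1)]) (use punct in auto)
  with punct have "F (0, w) = 0" if "norm w < s" for w using that by (cases "w = 0") auto
  then have "\<forall>\<^sub>F p in nhds (0, 0). fst p = 0 \<longrightarrow> F p = 0"
    using s(1) by (intro box_nhds_00[of s]) auto
  from holomorphic2_divide_fst[OF is_germ_of_holomorphic[OF F] this]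
  obtain G where G: "holomorphic2_near_0 G" "\<forall>\<^sub>F p in nhds (0, 0). F p = fst p * G p" by blast
  obtain g where g: "is_germ_of g G" using germ_of_exists[OF G(1)] by blast
  have "f = germ_u * g"
    using is_germ_of_eq_iff[OF F is_germ_of_mult[OF is_germ_of_u g]] G(2) by simp
  then show ?thesis by (rule dvdI)
qed

lemma germ_value_ideal:
  assumes "germ_value h = 0" "germ_value k = 0" "f \<in> ideal_pow h k 1"
  shows "germ_value f = 0"
  using assms by auto

text \<open>
  The Cohen-Macaulay property of the germ ring in the form used here: an ideal \<open>(h, k)\<close> of finite
  colength contains powers of both coordinates, which form a regular sequence.
\<close>

lemma koszul_exact_germ:
  assumes "germ_algebra.basis_mod n e (ideal_pow h k 1)"
  shows "koszul_exact h k"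
proof -
  have unit: "const_germ c * 1 + x * y dvd 1" if "c \<noteq> 0" "germ_value x = 0" for c x y
    by (rule germ_unit) (use that in simp)
  have span: "\<And>f. \<exists>c. f - (\<Sum>i<n. const_germ (c i) * e i) \<in> ideal_pow h k 1"
    using assms unfolding germ_algebra.basis_mod_def by blast
  have "germ_value germ_u = 0" "germ_value germ_v = 0"
    using germ_value_eq[OF is_germ_of_u] germ_value_eq[OF is_germ_of_v] by simp_all
  then obtain i j where i: "germ_u ^ i \<in> ideal_pow h k 1" and j: "germ_v ^ j \<in> ideal_pow h k 1"
    using germ_algebra.power_in_ideal[OF span, of germ_u] germ_algebra.power_in_ideal[OF span, of germ_v] unit
    by blast
  show ?thesis
  proof (rule koszul_exact_if_contains_regular[OF _ _ i j])
    show "germ_u ^ i * x = 0 \<Longrightarrow> x = 0" for x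
      by (rule coprime_powers_regular(1)[OF germ_u_cancel germ_u_dvd_v_mult])
    show "germ_u ^ i dvd germ_v ^ j * x \<Longrightarrow> germ_u ^ i dvd x" for x
      by (rule coprime_powers_regular(2)[OF germ_u_cancel germ_u_dvd_v_mult])
  qed
qed

theorem intersection_multiplicity_ge_six:
  assumes h: "germ_value h = 0" and k: "germ_value k = 0"
    and fin: "intersection_multiplicity h k \<noteq> \<infinity>"
    and f: "f \<in> ideal_pow h k 2" and g: "g \<in> ideal_pow h k 3"
  shows "6 * intersection_multiplicity h k \<le> intersection_multiplicity f g"
proof (cases "intersection_multiplicity f g")
  case (enat d)
  obtain n where n: "intersection_multiplicity h k = enat n" using fin by auto
  have hk1: "1 \<notin> ideal_pow h k 1" using germ_value_ideal[OF h k] by fastforce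
  have "f \<in> ideal_pow h k 1" "g \<in> ideal_pow h k 1"
    using f g ideal_pow_antimono[of 1 2 h k] ideal_pow_antimono[of 1 3 h k] by fastforce+
  then have "germ_value f = 0" "germ_value g = 0" using germ_value_ideal[OF h k] by blast+
  from germ_value_ideal[OF this, of 1] have fg1: "1 \<notin> ideal_pow f g 1" by fastforce
  obtain e where e: "germ_algebra.basis_mod n e (ideal_pow h k 1)"
    using intersection_multiplicity_basis[OF n hk1] by blast
  obtain e' where e': "germ_algebra.basis_mod d e' (ideal_pow f g 1)"
    using intersection_multiplicity_basis[OF enat fg1] by blast
  have "6 * n \<le> d"
    by (rule germ_algebra.colength_ge_six[OF koszul_exact_germ[OF e] e f g])
       (rule e'[unfolded germ_algebra.basis_mod_def, THEN conjunct1, rule_format])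
  then show ?thesis by (simp add: n enat numeral_eq_enat)
qed simp

section \<open>Complexification of real functions and of their partial derivatives\<close>

lemma is_complexification_cong:
  assumes "\<forall>\<^sub>F p in nhds (0, 0). f p = f' p" "is_complexification f g"
  shows "is_complexification f' g"
proof -
  obtain F where F: "is_germ_of g F" "\<forall>\<^sub>F p in nhds (0, 0). F (of_real (fst p), of_real (snd p)) = of_real (f p)"
    using assms(2) unfolding is_complexification_def by blast
  have "\<forall>\<^sub>F p in nhds (0, 0). F (of_real (fst p), of_real (snd p)) = of_real (f' p)"
    using F(2) assms(1) by eventually_elim simp
  with F(1) show ?thesis unfolding is_complexification_def by blast
qed

lemma is_complexification_const: "is_complexification (\<lambda>_. c) (const_germ (of_real c))"
  unfolding is_complexification_def using is_germ_of_const by (auto intro!: exI[of _ "\<lambda>_. of_real c"])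

lemma is_complexification_0: "is_complexification (\<lambda>_. 0) 0"
  using is_complexification_const[of 0] by simp

lemma is_complexification_add:
  assumes "is_complexification f g" "is_complexification f' g'"
  shows "is_complexification (\<lambda>p. f p + f' p) (g + g')"
proof -
  obtain F where F: "is_germ_of g F" "\<forall>\<^sub>F p in nhds (0, 0). F (of_real (fst p), of_real (snd p)) = of_real (f p)"
    using assms(1) unfolding is_complexification_def by blast
  obtain F' where F': "is_germ_of g' F'" "\<forall>\<^sub>F p in nhds (0, 0). F' (of_real (fst p), of_real (snd p)) = of_real (f' p)"
    using assms(2) unfolding is_complexification_def by blast
  show ?thesis unfolding is_complexification_def
    by (rule exI, rule conjI, rule is_germ_of_add[OF F(1) F'(1)])
       (use F(2) F'(2) in eventually_elim, simp)
qed

lemma is_complexification_diff: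
  assumes "is_complexification f g" "is_complexification f' g'"
  shows "is_complexification (\<lambda>p. f p - f' p) (g - g')"
proof -
  obtain F where F: "is_germ_of g F" "\<forall>\<^sub>F p in nhds (0, 0). F (of_real (fst p), of_real (snd p)) = of_real (f p)"
    using assms(1) unfolding is_complexification_def by blast
  obtain F' where F': "is_germ_of g' F'" "\<forall>\<^sub>F p in nhds (0, 0). F' (of_real (fst p), of_real (snd p)) = of_real (f' p)"
    using assms(2) unfolding is_complexification_def by blast
  show ?thesis unfolding is_complexification_def
    by (rule exI, rule conjI, rule is_germ_of_diff[OF F(1) F'(1)])
       (use F(2) F'(2) in eventually_elim, simp)
qed

lemma is_complexification_mult:
  assumes "is_complexification f g" "is_complexification f' g'"
  shows "is_complexification (\<lambda>p. f p * f' p) (g * g')"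
proof -
  obtain F where F: "is_germ_of g F" "\<forall>\<^sub>F p in nhds (0, 0). F (of_real (fst p), of_real (snd p)) = of_real (f p)"
    using assms(1) unfolding is_complexification_def by blast
  obtain F' where F': "is_germ_of g' F'" "\<forall>\<^sub>F p in nhds (0, 0). F' (of_real (fst p), of_real (snd p)) = of_real (f' p)"
    using assms(2) unfolding is_complexification_def by blast
  show ?thesis unfolding is_complexification_def
    by (rule exI, rule conjI, rule is_germ_of_mult[OF F(1) F'(1)])
       (use F(2) F'(2) in eventually_elim, simp)
qed

lemma complexification_eqI: "is_complexification f g \<Longrightarrow> complexification f = g"
  unfolding complexification_def using complexification_unique by blast

lemma germ_value_complexification:
  assumes "is_complexification f g"
  shows "germ_value g = of_real (f (0, 0))"
proof -
  obtain F where F: "is_germ_of g F" "\<forall>\<^sub>F p in nhds (0, 0). F (of_real (fst p), of_real (snd p)) = of_real (f p)"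
    using assms unfolding is_complexification_def by blast
  from eventually_nhds_x_imp_x[OF F(2)] show ?thesis by (simp add: germ_value_eq[OF F(1)])
qed

lemma is_complexification_swap:
  assumes "is_complexification f g"
  shows "\<exists>g'. is_complexification (\<lambda>p. f (snd p, fst p)) g'"
proof -
  obtain F where F: "is_germ_of g F" "\<forall>\<^sub>F p in nhds (0, 0). F (of_real (fst p), of_real (snd p)) = of_real (f p)"
    using assms unfolding is_complexification_def by blast
  obtain g' where "is_germ_of g' (\<lambda>p. F (snd p, fst p))"
    using germ_of_exists[OF holomorphic2_near_0_swap[OF is_germ_of_holomorphic[OF F(1)]]] by blast
  then show ?thesis
    unfolding is_complexification_def using eventually_nhds_swap[OF F(2)]
    by (intro exI[of _ g'] exI[of _ "\<lambda>p. F (snd p, fst p)"]) simp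
qed

text \<open>
  On real points the complex derivative of a complexification in the first variable is the real one.
  The function is real there, so the imaginary part of the derivative is the derivative of \<open>0\<close>.
\<close>

lemma complexification_partial_u:
  assumes "is_complexification f g"
  shows "\<exists>g'. is_complexification (partial_u f) g'"
    and "\<forall>\<^sub>F p in nhds (0, 0). ((\<lambda>s. f (s, snd p)) has_real_derivative partial_u f p) (at (fst p))"
proof -
  obtain F where F: "is_germ_of g F" "\<forall>\<^sub>F p in nhds (0, 0). F (of_real (fst p), of_real (snd p)) = of_real (f p)"
    using assms unfolding is_complexification_def by blast
  obtain G where G: "holomorphic2_near_0 G"
    "\<forall>\<^sub>F p in nhds (0, 0). ((\<lambda>z. F (z, snd p)) has_field_derivative G p) (at (fst p))"
    using holomorphic2_deriv_fst[OF is_germ_of_holomorphic[OF F(1)]] by blast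
  from F(2) obtain r1 where r1: "r1 > 0" "\<And>s t. norm s < r1 \<Longrightarrow> norm t < r1 \<Longrightarrow> F (of_real s, of_real t) = of_real (f (s, t))"
    by (rule nhds_00_box) auto
  from G(2) obtain r2 where r2: "r2 > 0" "\<And>z w. norm z < r2 \<Longrightarrow> norm w < r2 \<Longrightarrow>
      ((\<lambda>z. F (z, w)) has_field_derivative G (z, w)) (at z)"
    by (rule nhds_00_box) auto
  define r where "r = min r1 r2"
  have r: "r > 0" using r1 r2 by (simp add: r_def)
  have *: "((\<lambda>s. f (s, t)) has_real_derivative partial_u f (s, t)) (at s) \<and>
      G (of_real s, of_real t) = of_real (partial_u f (s, t))" if s: "norm s < r" and t: "norm t < r" for s t
  proof -
    let ?G = "G (of_real s, of_real t)"
    have "((\<lambda>z. F (z, of_real t)) has_field_derivative ?G) (at (of_real s))"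
      using r2(2)[of "of_real s" "of_real t"] s t by (simp add: r_def)
    then have "((\<lambda>s. F (of_real s, of_real t)) has_vector_derivative ?G) (at s)"
      by (rule has_vector_derivative_real_field)
    then have d: "((\<lambda>s. of_real (f (s, t))) has_vector_derivative ?G) (at s)"
      by (rule has_vector_derivative_transform_within_open[of _ _ _ "ball 0 r"])
         (use r1(2) s t in \<open>auto simp: r_def\<close>)
    have "((\<lambda>s. f (s, t)) has_vector_derivative Re ?G) (at s)"
      using bounded_linear.has_vector_derivative[OF bounded_linear_Re d] by simp
    moreover have "((\<lambda>s. 0) has_vector_derivative Im ?G) (at s)"
      using bounded_linear.has_vector_derivative[OF bounded_linear_Im d] by simp
    then have "Im ?G = 0"
      using vector_derivative_unique_at[OF _ has_vector_derivative_const] by blast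
    ultimately show ?thesis
      unfolding partial_u_def by (auto simp: has_real_derivative_iff_has_vector_derivative vector_derivative_at complex_eq_iff)
  qed
  obtain g' where "is_germ_of g' G" using germ_of_exists[OF G(1)] by blast
  then show "\<exists>g'. is_complexification (partial_u f) g'"
    unfolding is_complexification_def using * by (auto intro!: exI[of _ g'] exI[of _ G] box_nhds_00[OF r])
  show "\<forall>\<^sub>F p in nhds (0, 0). ((\<lambda>s. f (s, snd p)) has_real_derivative partial_u f p) (at (fst p))"
    using * by (intro box_nhds_00[OF r]) auto
qed

lemma partial_v_eq_partial_u_swap: "partial_v f p = partial_u (\<lambda>p. f (snd p, fst p)) (snd p, fst p)"
  by (simp add: partial_u_def partial_v_def)

lemma complexification_partial_v:
  assumes "is_complexification f g"
  shows "\<exists>g'. is_complexification (partial_v f) g'"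
    and "\<forall>\<^sub>F p in nhds (0, 0). ((\<lambda>t. f (fst p, t)) has_real_derivative partial_v f p) (at (snd p))"
proof -
  obtain g1 where g1: "is_complexification (\<lambda>p. f (snd p, fst p)) g1" using is_complexification_swap[OF assms] by blast
  obtain g2 where "is_complexification (partial_u (\<lambda>p. f (snd p, fst p))) g2"
    using complexification_partial_u(1)[OF g1] by blast
  from is_complexification_swap[OF this]
  show "\<exists>g'. is_complexification (partial_v f) g'" unfolding partial_v_eq_partial_u_swap[abs_def] .
  show "\<forall>\<^sub>F p in nhds (0, 0). ((\<lambda>t. f (fst p, t)) has_real_derivative partial_v f p) (at (snd p))"
    using eventually_nhds_swap[OF complexification_partial_u(2)[OF g1]]
    unfolding partial_v_eq_partial_u_swap by simp
qed

text \<open>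
  The class of functions in which the coefficients of the differential equation are formed. It is
  closed under ring operations and partial derivatives, so power series enter only through the
  components of the parametrisation.
\<close>

definition complexifiable :: "(real \<times> real \<Rightarrow> real) \<Rightarrow> bool"
  where "complexifiable f \<longleftrightarrow> (\<exists>g. is_complexification f g)"

lemma complexifiableD: "complexifiable f \<Longrightarrow> is_complexification f (complexification f)"
  unfolding complexifiable_def using complexification_eqI by metis

lemma complexifiable_cong:
  "complexifiable f \<Longrightarrow> \<forall>\<^sub>F p in nhds (0, 0). f p = f' p \<Longrightarrow> complexifiable f'"
  unfolding complexifiable_def using is_complexification_cong by blast

lemma complexifiable_add: "complexifiable f \<Longrightarrow> complexifiable g \<Longrightarrow> complexifiable (\<lambda>p. f p + g p)"
  and complexifiable_diff: "complexifiable f \<Longrightarrow> complexifiable g \<Longrightarrow> complexifiable (\<lambda>p. f p - g p)"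
  and complexifiable_mult: "complexifiable f \<Longrightarrow> complexifiable g \<Longrightarrow> complexifiable (\<lambda>p. f p * g p)"
  unfolding complexifiable_def
  using is_complexification_add is_complexification_diff is_complexification_mult by blast+

definition complexifiable3 :: "(real \<times> real \<Rightarrow> real ^ 3) \<Rightarrow> bool"
  where "complexifiable3 x \<longleftrightarrow> (\<forall>i. complexifiable (\<lambda>p. x p $ i))"

lemma has_vector_derivative_vec_nth:
  fixes f :: "real \<Rightarrow> real ^ 'n"
  assumes "\<And>i. ((\<lambda>s. f s $ i) has_real_derivative d $ i) (at s)"
  shows "(f has_vector_derivative d) (at s)"
proof -
  have "(\<lambda>s. s * d $ i) = (*) (d $ i)" for i by (simp add: fun_eq_iff)
  then show ?thesis
    unfolding has_vector_derivative_def
    by (subst has_derivative_componentwise_within)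
       (use assms in \<open>auto simp: Basis_vec_def inner_axis has_field_derivative_def\<close>)
qed

lemma partial_u_nth:
  assumes "complexifiable3 x"
  shows "\<forall>\<^sub>F p in nhds (0, 0). partial_u (\<lambda>p. x p $ i) p = partial_u x p $ i"
proof -
  have "\<forall>\<^sub>F p in nhds (0, 0). \<forall>i. ((\<lambda>s. x (s, snd p) $ i) has_real_derivative partial_u (\<lambda>p. x p $ i) p) (at (fst p))"
    using assms complexification_partial_u(2) unfolding complexifiable3_def complexifiable_def
    by (intro eventually_all_finite) blast
  then show ?thesis
  proof eventually_elim
    case (elim p)
    have "((\<lambda>s. x (s, snd p)) has_vector_derivative (\<chi> i. partial_u (\<lambda>p. x p $ i) p)) (at (fst p))"
      by (rule has_vector_derivative_vec_nth) (use elim in simp)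
    then have "partial_u x p = (\<chi> i. partial_u (\<lambda>p. x p $ i) p)"
      unfolding partial_u_def by (rule vector_derivative_at)
    then show ?case by simp
  qed
qed

lemma complexifiable3_partial_u:
  assumes "complexifiable3 x" shows "complexifiable3 (partial_u x)"
  unfolding complexifiable3_def
proof
  fix i
  have "complexifiable (partial_u (\<lambda>p. x p $ i))"
    using assms complexification_partial_u(1) unfolding complexifiable3_def complexifiable_def by blast
  then show "complexifiable (\<lambda>p. partial_u x p $ i)"
    by (rule complexifiable_cong) (rule partial_u_nth[OF assms])
qed

lemma complexifiable3_swap: "complexifiable3 x \<Longrightarrow> complexifiable3 (\<lambda>p. x (snd p, fst p))"
  unfolding complexifiable3_def complexifiable_def using is_complexification_swap by blast

lemma complexifiable3_partial_v:
  assumes "complexifiable3 x" shows "complexifiable3 (partial_v x)"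
  using complexifiable3_swap[OF complexifiable3_partial_u[OF complexifiable3_swap[OF assms]]]
  unfolding partial_v_eq_partial_u_swap[abs_def] by simp

lemma complexifiable_mink_inner:
  "complexifiable3 x \<Longrightarrow> complexifiable3 y \<Longrightarrow> complexifiable (\<lambda>p. mink_inner (x p) (y p))"
  unfolding mink_inner_def complexifiable3_def
  by (intro complexifiable_add complexifiable_diff complexifiable_mult) auto

lemma complexifiable3_mink_cross:
  "complexifiable3 x \<Longrightarrow> complexifiable3 y \<Longrightarrow> complexifiable3 (\<lambda>p. mink_cross (x p) (y p))"
  unfolding mink_cross_def complexifiable3_def forall_3 vector_3
  by (intro conjI complexifiable_add complexifiable_diff complexifiable_mult) auto

lemma complexifiable3_real_analytic:
  assumes "real_analytic_at x (0, 0)"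
  shows "complexifiable3 x"
  unfolding complexifiable3_def
proof
  fix i
  obtain c where "\<forall>\<^sub>F p in nhds (0, 0). ((\<lambda>(i, j). (fst p ^ i * snd p ^ j) *\<^sub>R c (i, j)) has_sum x p) UNIV"
    using assms unfolding real_analytic_at_def fst_conv snd_conv diff_zero by blast
  then have "\<forall>\<^sub>F p in nhds (0, 0). ((\<lambda>(k, j). (fst p ^ k * snd p ^ j) *\<^sub>R (c (k, j) $ i)) has_sum (x p $ i)) UNIV"
  proof eventually_elim
    case (elim p)
    from has_sum_bounded_linear[OF bounded_linear_vec_nth[of i] elim]
    show ?case by (simp add: o_def case_prod_unfold)
  qed
  then have "real_analytic_at (\<lambda>p. x p $ i) (0, 0)"
    unfolding real_analytic_at_def by (intro exI[of _ "\<lambda>p. c p $ i"]) simp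
  then show "complexifiable (\<lambda>p. x p $ i)" unfolding complexifiable_def by (rule complexification_exists)
qed

lemma complexifiable_curv:
  assumes "complexifiable3 x"
  shows "complexifiable (fund_E x)" "complexifiable (fund_F x)" "complexifiable (fund_G x)"
    and "complexifiable (curv_a x)" "complexifiable (curv_b x)" "complexifiable (curv_c x)"
proof -
  note intros = assms complexifiable3_partial_u complexifiable3_partial_v complexifiable_mink_inner
    complexifiable3_mink_cross
  show E: "complexifiable (fund_E x)" and F: "complexifiable (fund_F x)" and G: "complexifiable (fund_G x)"
    unfolding fund_E_def[abs_def] fund_F_def[abs_def] fund_G_def[abs_def] by (intro intros)+
  have l: "complexifiable (fund_l x)" and m: "complexifiable (fund_m x)" and n: "complexifiable (fund_n x)"
    unfolding fund_l_def[abs_def] fund_m_def[abs_def] fund_n_def[abs_def] by (intro intros)+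
  show "complexifiable (curv_a x)" "complexifiable (curv_b x)" "complexifiable (curv_c x)"
    unfolding curv_a_def[abs_def] curv_b_def[abs_def] curv_c_def[abs_def]
    by (intro complexifiable_diff complexifiable_mult E F G l m n)+
qed

section \<open>Principal curvature lines at an umbilic point\<close>

text \<open>
  A plane contains a vector with vanishing third coordinate, on which the pseudo-scalar product is
  positive definite. Therefore \<open>E\<close>, \<open>F\<close>, \<open>G\<close> cannot all vanish at a point of the surface.
\<close>

lemma mink_no_isotropic_plane:
  assumes "independent {u, v}" "u \<noteq> v" "mink_inner u u = 0" "mink_inner u v = 0" "mink_inner v v = 0"
  shows False
proof -
  define w where "w = v $ 3 *\<^sub>R u - u $ 3 *\<^sub>R v"
  have "mink_inner w w = (v $ 3)\<^sup>2 * mink_inner u u - 2 * (u $ 3) * (v $ 3) * mink_inner u v + (u $ 3)\<^sup>2 * mink_inner v v"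
    by (simp add: w_def mink_inner_def power2_eq_square algebra_simps)
  then have "mink_inner w w = 0" using assms by simp
  moreover have "w $ 3 = 0" by (simp add: w_def)
  ultimately have "(w $ 1)\<^sup>2 + (w $ 2)\<^sup>2 = 0" by (simp add: mink_inner_def power2_eq_square)
  then have "w $ 1 = 0" "w $ 2 = 0" by (simp_all add: sum_power2_eq_zero_iff)
  with \<open>w $ 3 = 0\<close> have "w = 0" by (simp add: vec_eq_iff forall_3)
  have u3: "u $ 3 = 0"
  proof (rule ccontr)
    assume "u $ 3 \<noteq> 0"
    then have "v = (v $ 3 / u $ 3) *\<^sub>R u"
      using \<open>w = 0\<close> by (simp add: w_def vec_eq_iff field_simps)
    then have "v \<in> span {u}" by (metis span_base span_scale singletonI)
    then show False using assms(1,2) by (simp add: independent_insert insert_commute[of u v])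
  qed
  then have "(u $ 1)\<^sup>2 + (u $ 2)\<^sup>2 = 0" using assms(3) by (simp add: mink_inner_def power2_eq_square)
  then have "u $ 1 = 0" "u $ 2 = 0" by (simp_all add: sum_power2_eq_zero_iff)
  with u3 have "u = 0" by (simp add: vec_eq_iff forall_3)
  then show False using assms(1) dependent_zero by blast
qed

lemma germ_in_ideal_of_unit:
  assumes "e * a \<in> ideal_pow h k 1" "germ_value e \<noteq> 0"
  shows "a \<in> ideal_pow h k 1"
proof -
  obtain w where "1 = e * w" using germ_unit[OF assms(2)] by (rule dvdE)
  then have "a = w * (e * a)" by (metis mult.assoc mult.commute mult_1_left)
  then show ?thesis using ideal_pow_mult[OF assms(1), of w] by simp
qed

text \<open>
  If the coefficients lie in \<open>I\<close>, the discriminant lies in \<open>I\<^sup>2\<close>. By the product rule its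
  partial derivatives still lie in \<open>I\<close>, so the second function in the definition of the multiplicity
  lies in \<open>I\<^sup>3\<close>.
\<close>

lemma bde_multiplicity_ge:
  assumes a: "is_complexification a A" and b: "is_complexification b B" and c: "is_complexification c C"
    and I: "A \<in> ideal_pow H K 1" "B \<in> ideal_pow H K 1" "C \<in> ideal_pow H K 1"
    and H: "germ_value H = 0" "germ_value K = 0" and fin: "intersection_multiplicity H K \<noteq> \<infinity>"
  shows "bde_multiplicity (a, b, c) \<ge> 3 * ereal_of_enat (intersection_multiplicity H K)"
proof -
  let ?I = "ideal_pow H K"
  obtain A1 A2 B1 B2 C1 C2 where
    A1: "is_complexification (partial_u a) A1" and A2: "is_complexification (partial_v a) A2" and
    B1: "is_complexification (partial_u b) B1" and B2: "is_complexification (partial_v b) B2" and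
    C1: "is_complexification (partial_u c) C1" and C2: "is_complexification (partial_v c) C2"
    using complexification_partial_u(1)[OF a] complexification_partial_v(1)[OF a]
      complexification_partial_u(1)[OF b] complexification_partial_v(1)[OF b]
      complexification_partial_u(1)[OF c] complexification_partial_v(1)[OF c] by blast
  define \<delta> where "\<delta> = bde_discriminant (a, b, c)"
  define four where "four = const_germ (of_real 4)"
  have four: "is_complexification (\<lambda>_. 4) four" unfolding four_def by (rule is_complexification_const)
  define D where "D = B * B - four * A * C"
  have D: "is_complexification \<delta> D"
    unfolding \<delta>_def bde_discriminant_def D_def prod.case power2_eq_square
    by (intro is_complexification_diff is_complexification_mult a b c four)
  define E1 where "E1 = (B1 * B + B * B1) - four * (A1 * C + A * C1)"
  define E2 where "E2 = (B2 * B + B * B2) - four * (A2 * C + A * C2)"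
  have "\<forall>\<^sub>F p in nhds (0, 0). (partial_u b p * b p + b p * partial_u b p) -
      4 * (partial_u a p * c p + a p * partial_u c p) = partial_u \<delta> p"
    using complexification_partial_u(2)[OF a] complexification_partial_u(2)[OF b] complexification_partial_u(2)[OF c]
  proof eventually_elim
    case (elim p)
    have "((\<lambda>s. \<delta> (s, snd p)) has_real_derivative (partial_u b p * b p + b p * partial_u b p) -
      4 * (partial_u a p * c p + a p * partial_u c p)) (at (fst p))"
      unfolding \<delta>_def bde_discriminant_def prod.case
      by (rule derivative_eq_intros refl elim | simp add: algebra_simps)+
    then show ?case
      unfolding partial_u_def[of \<delta>] has_real_derivative_iff_has_vector_derivative by (metis vector_derivative_at)
  qed
  then have E1: "is_complexification (partial_u \<delta>) E1"
    by (rule is_complexification_cong) (unfold E1_def, intro is_complexification_add is_complexification_diff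
        is_complexification_mult four a b c A1 B1 C1)
  have "\<forall>\<^sub>F p in nhds (0, 0). (partial_v b p * b p + b p * partial_v b p) -
      4 * (partial_v a p * c p + a p * partial_v c p) = partial_v \<delta> p"
    using complexification_partial_v(2)[OF a] complexification_partial_v(2)[OF b] complexification_partial_v(2)[OF c]
  proof eventually_elim
    case (elim p)
    have "((\<lambda>s. \<delta> (fst p, s)) has_real_derivative (partial_v b p * b p + b p * partial_v b p) -
      4 * (partial_v a p * c p + a p * partial_v c p)) (at (snd p))"
      unfolding \<delta>_def bde_discriminant_def prod.case
      by (rule derivative_eq_intros refl elim | simp add: algebra_simps)+
    then show ?case
      unfolding partial_v_def[of \<delta>] has_real_derivative_iff_has_vector_derivative by (metis vector_derivative_at)
  qed
  then have E2: "is_complexification (partial_v \<delta>) E2"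
    by (rule is_complexification_cong) (unfold E2_def, intro is_complexification_add is_complexification_diff
        is_complexification_mult four a b c A2 B2 C2)
  define P where "P = A * (E1 * E1) - B * E1 * E2 + C * (E2 * E2)"
  have P: "is_complexification (\<lambda>p. a p * (partial_u \<delta> p)\<^sup>2 - b p * partial_u \<delta> p * partial_v \<delta> p + c p * (partial_v \<delta> p)\<^sup>2) P"
    unfolding P_def power2_eq_square
    by (intro is_complexification_add is_complexification_diff is_complexification_mult a b c E1 E2)
  have prod: "x * y \<in> ?I (Suc n)" if "x \<in> ?I 1" "y \<in> ?I n" for x y n
    using ideal_pow_prod[OF that] by (simp del: ideal_pow.simps)
  have right: "x * y \<in> ?I n" if "x \<in> ?I n" for x y n
    using ideal_pow_mult[OF that, of y] by (simp only: mult.commute)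
  have D2: "D \<in> ?I 2"
    unfolding D_def mult.assoc numeral_2_eq_2
    by (intro ideal_pow_diff ideal_pow_mult prod) (use I in \<open>simp_all only: One_nat_def\<close>)
  have EI: "E1 \<in> ?I 1" "E2 \<in> ?I 1"
    unfolding E1_def E2_def
    by (intro ideal_pow_diff ideal_pow_add ideal_pow_mult right I(2); rule ideal_pow_mult I right)+
  have P3: "P \<in> ?I 3"
    unfolding P_def mult.assoc numeral_3_eq_3
    by (intro ideal_pow_diff ideal_pow_add prod) (use I EI in \<open>simp_all only: One_nat_def\<close>)
  have "6 * intersection_multiplicity H K \<le> intersection_multiplicity D P"
    by (rule intersection_multiplicity_ge_six[OF H fin D2 P3])
  then have "ereal_of_enat (6 * intersection_multiplicity H K) \<le> ereal_of_enat (intersection_multiplicity D P)"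
    by (simp only: ereal_of_enat_le_iff)
  moreover have "bde_multiplicity (a, b, c) = ereal_of_enat (intersection_multiplicity D P) / 2"
    unfolding bde_multiplicity_def real_multiplicity_def Let_def prod.case \<delta>_def[symmetric]
    by (simp only: complexification_eqI[OF D] complexification_eqI[OF P])
  ultimately show ?thesis
    using fin by (cases "intersection_multiplicity H K"; cases "intersection_multiplicity D P")
      (auto simp: numeral_eq_enat)
qed

theorem theorem3p7:
  fixes M :: "(real ^ 3) set" and p :: "real ^ 3"
    and U :: "(real \<times> real) set" and x :: "real \<times> real \<Rightarrow> real ^ 3"
  assumes "regular_analytic_surface M"
    and "p \<in> M"
    and "local_analytic_parametrization M U x"
    and "(0, 0) \<in> U" and "x (0, 0) = p"
    and "umbilic_at x (0, 0)"
    and "umbilic_multiplicity x \<noteq> \<infinity>"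
    and "bde_multiplicity (principal_curvature_bde x) \<noteq> \<infinity>"
  shows "bde_multiplicity (principal_curvature_bde x) \<ge> 3 * ereal_of_enat (umbilic_multiplicity x)"
proof -
  have "real_analytic_at x (0, 0)" and indep: "partial_u x (0, 0) \<noteq> partial_v x (0, 0)"
    "independent {partial_u x (0, 0), partial_v x (0, 0)}"
    using assms(3,4) unfolding local_analytic_parametrization_def by blast+
  then have x: "complexifiable3 x" by (intro complexifiable3_real_analytic)
  define E F G A B C where "E = complexification (fund_E x)" and "F = complexification (fund_F x)"
    and "G = complexification (fund_G x)" and "A = complexification (curv_a x)"
    and "B = complexification (curv_b x)" and "C = complexification (curv_c x)"
  have E: "is_complexification (fund_E x) E" and F: "is_complexification (fund_F x) F"
    and G: "is_complexification (fund_G x) G" and A: "is_complexification (curv_a x) A"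
    and B: "is_complexification (curv_b x) B" and C: "is_complexification (curv_c x) C"
    unfolding E_def F_def G_def A_def B_def C_def using complexifiable_curv[OF x] complexifiableD by blast+
  have "is_complexification (\<lambda>q. fund_E x q * curv_a x q - fund_F x q * curv_b x q + fund_G x q * curv_c x q)
      (E * A - F * B + G * C)"
    by (intro is_complexification_add is_complexification_diff is_complexification_mult A B C E F G)
  then have syzygy: "E * A - F * B + G * C = 0"
    unfolding curv_syzygy using complexification_unique is_complexification_0 by blast
  have zero: "germ_value A = 0" "germ_value B = 0" "germ_value C = 0"
    using assms(6) germ_value_complexification[OF A] germ_value_complexification[OF B]
      germ_value_complexification[OF C] by (simp_all add: umbilic_at_def)
  have val: "germ_value E = of_real (fund_E x (0, 0))" "germ_value F = of_real (fund_F x (0, 0))"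
    "germ_value G = of_real (fund_G x (0, 0))"
    using germ_value_complexification E F G by blast+
  have gen: "h \<in> ideal_pow h k 1" "k \<in> ideal_pow h k 1" for h k :: germ2
  proof -
    have "h = 1 * h + 0 * k" "k = 0 * h + 1 * k" by simp_all
    then show "h \<in> ideal_pow h k 1" "k \<in> ideal_pow h k 1" unfolding ideal_pow_1 by blast+
  qed
  have comb: "y * h + z * k \<in> ideal_pow h k 1" for h k y z :: germ2
    unfolding ideal_pow_1 by blast
  have "\<exists>H K. umbilic_multiplicity x = intersection_multiplicity H K \<and> germ_value H = 0 \<and> germ_value K = 0 \<and>
    A \<in> ideal_pow H K 1 \<and> B \<in> ideal_pow H K 1 \<and> C \<in> ideal_pow H K 1"
  proof (cases "fund_E x (0, 0) = 0")
    case False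
    have "E * A = F * B + (- G) * C" using syzygy by (simp add: algebra_simps)
    then have "E * A \<in> ideal_pow B C 1" using comb by presburger
    then have "A \<in> ideal_pow B C 1" by (rule germ_in_ideal_of_unit) (use False val in simp)
    then show ?thesis using False gen zero
      by (intro exI[of _ B] exI[of _ C]) (simp add: umbilic_multiplicity_def real_multiplicity_def B_def C_def)
  next
    case E0: True
    show ?thesis
    proof (cases "fund_F x (0, 0) = 0")
      case False
      have "F * B = E * A + G * C" using syzygy by (simp add: algebra_simps)
      then have "F * B \<in> ideal_pow A C 1" using comb by presburger
      then have "B \<in> ideal_pow A C 1" by (rule germ_in_ideal_of_unit) (use False val in simp)
      then show ?thesis using False E0 gen zero
        by (intro exI[of _ A] exI[of _ C]) (simp add: umbilic_multiplicity_def real_multiplicity_def A_def C_def)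
    next
      case F0: True
      have G0: "fund_G x (0, 0) \<noteq> 0"
        using mink_no_isotropic_plane[OF indep(2,1)] E0 F0 by (auto simp: fund_E_def fund_F_def fund_G_def)
      have "G * C = (- E) * A + F * B" using syzygy by (simp add: algebra_simps)
      then have "G * C \<in> ideal_pow A B 1" using comb by presburger
      then have "C \<in> ideal_pow A B 1" by (rule germ_in_ideal_of_unit) (use G0 val in simp)
      then show ?thesis using F0 E0 gen zero
        by (intro exI[of _ A] exI[of _ B]) (simp add: umbilic_multiplicity_def real_multiplicity_def A_def B_def)
    qed
  qed
  then obtain H K where HK: "umbilic_multiplicity x = intersection_multiplicity H K"
    "germ_value H = 0" "germ_value K = 0"
    "A \<in> ideal_pow H K 1" "B \<in> ideal_pow H K 1" "C \<in> ideal_pow H K 1" by blast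
  show ?thesis
    unfolding principal_curvature_bde_def HK(1)
    by (rule bde_multiplicity_ge[OF A B C HK(4-6) HK(2,3)]) (use assms(7) HK(1) in simp)
qed

end
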